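(* Let $R\in(0,1)$ ($R\approx 0.493411$) be the positive root of the equation $2\left(-r-\log(1-r)\right)=r(1-r^2)$. The equation $$-\frac{1}{r}\log (1+r)+\frac{-r-\log (1-r)}{2r}\left(-\frac{1}{r}\log (1-r)+\frac{1}{r}\log(1+r)+\frac{2}{1+r}\right)+2\left(\frac{r^2}{1-r}+r+2+\frac{2}{r}\log(1-r)\right)=0$$ has a unique root $r_1$ in $(0,1)$, and $r_1\leq R$. If $f\in\mathcal{B}$ with $f(z)=\sum_{n=0}^\infty a_n z^n$ for $z\in\mathbb{D}$, then $$\left|\mathcal{C}f(z)\right|+\left|\mathcal{C}f'(z)\right|\phi_1(r)+\sum_{k=2}^{\infty}\left|a_k\right|\phi_k(r)\leq \frac{1}{r}\log \frac{1}{1-r}$$ for all $z$ with $|z|=r\leq r_1$. The number $r_1$ is the best possible, i.e. for no number $\rho\in(r_1,1)$ does this inequality hold for all $f\in\mathcal{B}$ and all $z$ with $|z|=r\leq \rho$.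
   Context: $\mathbb{D}=\{z\in\mathbb{C}:|z|<1\}$, and $\mathcal{B}$ is the class of analytic functions $f$ on $\mathbb{D}$ with $|f(z)|\leq 1$ for all $z\in\mathbb{D}$. For an analytic function $g(z)=\sum_{n=0}^\infty b_n z^n$ on $\mathbb{D}$, the Cesàro operator is $$\mathcal{C}g(z)=\sum_{n=0}^\infty \frac{1}{n+1}\left(\sum_{k=0}^n b_k\right) z^n=\int_0^1\frac{g(tz)}{1-tz}\,dt,\qquad z\in\mathbb{D}.$$ $\mathcal{C}f'$ denotes $\mathcal{C}$ applied to the derivative $f'$. For integers $k\ge 0$ and $r\in(0,1)$, $$\phi_k(r)=\sum_{i=k}^\infty\frac{r^i}{i+1}=\frac{1}{r}\int_0^r\frac{x^k}{1-x}\,dx.$$ At $r=0$, expressions such as $\frac1r\log\frac1{1-r}$ and $\phi_k(r)$ are understood as their limits as $r\to0^+$. $\log$ is the natural logarithm. *)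

theory Defs
  imports "HOL-Complex_Analysis.Complex_Analysis" "HOL-Real_Asymp.Real_Asymp"
begin

definition bounded_class :: "(complex \<Rightarrow> complex) set" where
  "bounded_class = {f. f analytic_on ball 0 1 \<and> (\<forall>z\<in>ball 0 1. cmod (f z) \<le> 1)}"

definition taylor_coeff :: "(complex \<Rightarrow> complex) \<Rightarrow> nat \<Rightarrow> complex" where
  "taylor_coeff g n = (deriv ^^ n) g 0 / fact n"

definition cesaro :: "(complex \<Rightarrow> complex) \<Rightarrow> complex \<Rightarrow> complex" where
  "cesaro g z = (\<Sum>n. 1 / of_nat (n + 1) * (\<Sum>k\<le>n. taylor_coeff g k) * z ^ n)"

text \<open>The series \<open>\<Sum>i\<ge>k. r\<^sup>i / (i + 1)\<close>, with the index shifted to start at 0.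
  Since \<open>0 ^ 0 = 1\<close>, its value at \<open>r = 0\<close> is the limit from the right.\<close>

definition phi :: "nat \<Rightarrow> real \<Rightarrow> real" where
  "phi k r = (\<Sum>i. r ^ (k + i) / real (k + i + 1))"

lemma phi_at_0: "phi k 0 = (if k = 0 then 1 else 0)"
proof -
  have "phi k 0 = (\<Sum>i. if i = 0 then (if k = 0 then 1 else 0) else 0)"
    unfolding phi_def by (rule suminf_cong) (auto simp: power_0_left)
  also have "\<dots> = (if k = 0 then 1 else 0)"
    using sums_single[of 0 "\<lambda>_. if k = 0 then 1 else (0::real)"] by (simp add: sums_iff)
  finally show ?thesis .
qed

lemma phi_tendsto_0: "(phi k \<longlongrightarrow> phi k 0) (at_right 0)"
proof -
  let ?c = "\<lambda>i. 1 / real (k + i + 1)"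
  have sm: "summable (\<lambda>i. ?c i * (1/2) ^ i)"
  proof (rule summable_comparison_test'[of "\<lambda>i. (1/2::real) ^ i" 0])
    show "summable (\<lambda>i. (1/2::real) ^ i)" by (rule summable_geometric) simp
  qed (auto simp: divide_simps)
  have "isCont (\<lambda>r. r ^ k * (\<Sum>i. ?c i * r ^ i)) (0::real)"
    by (intro continuous_intros isCont_powser[OF sm]) auto
  then have lim: "((\<lambda>r. r ^ k * (\<Sum>i. ?c i * r ^ i)) \<longlongrightarrow> 0 ^ k * (\<Sum>i. ?c i * 0 ^ i)) (at_right 0)"
    unfolding isCont_def by (rule filterlim_mono[OF _ order_refl]) (simp add: at_le)
  have eq: "phi k r = r ^ k * (\<Sum>i. ?c i * r ^ i)" if "\<bar>r\<bar> < 1/2" for r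
  proof -
    have "summable (\<lambda>i. ?c i * r ^ i)"
      by (rule powser_inside[OF sm]) (use that in auto)
    then have "r ^ k * (\<Sum>i. ?c i * r ^ i) = (\<Sum>i. r ^ k * (?c i * r ^ i))"
      by (rule suminf_mult[symmetric])
    then show ?thesis by (simp add: phi_def power_add)
  qed
  have "eventually (\<lambda>r. r \<in> {0<..<1/2}) (at_right (0::real))"
    by (rule eventually_at_right_real) simp
  then have "eventually (\<lambda>r. r ^ k * (\<Sum>i. ?c i * r ^ i) = phi k r) (at_right 0)"
    by eventually_elim (subst eq, auto)
  from Lim_transform_eventually[OF lim this] show ?thesis by (subst eq[of 0]) simp_all
qed

text \<open>The value at \<open>r = 0\<close> is the limit from the right.\<close>

definition log_mean :: "real \<Rightarrow> real" where
  "log_mean r = (if r = 0 then 1 else 1 / r * ln (1 / (1 - r)))"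

lemma log_mean_tendsto_0: "(log_mean \<longlongrightarrow> log_mean 0) (at_right 0)"
proof -
  have "((\<lambda>r::real. 1 / r * ln (1 / (1 - r))) \<longlongrightarrow> 1) (at_right 0)"
    by real_asymp
  moreover have "eventually (\<lambda>r. 1 / r * ln (1 / (1 - r)) = log_mean r) (at_right 0)"
    by (auto simp: log_mean_def eventually_at_filter)
  ultimately show ?thesis
    by (auto simp: log_mean_def[of 0] intro: Lim_transform_eventually)
qed

definition cesaro_bohr_ineq :: "(complex \<Rightarrow> complex) \<Rightarrow> (nat \<Rightarrow> complex) \<Rightarrow> complex \<Rightarrow> bool" where
  "cesaro_bohr_ineq f a z \<longleftrightarrow>
     cmod (cesaro f z) + cmod (cesaro (deriv f) z) * phi 1 (cmod z)
       + (\<Sum>k. cmod (a (k + 2)) * phi (k + 2) (cmod z))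
     \<le> log_mean (cmod z)"

definition radius_lhs :: "real \<Rightarrow> real" where
  "radius_lhs r =
     - (1 / r) * ln (1 + r)
     + (- r - ln (1 - r)) / (2 * r)
         * (- (1 / r) * ln (1 - r) + 1 / r * ln (1 + r) + 2 / (1 + r))
     + 2 * (r\<^sup>2 / (1 - r) + r + 2 + 2 / r * ln (1 - r))"

end

theory Submission
  imports Defs
begin

text \<open>
  Since \<open>z * cesaro g z\<close> is a primitive of \<open>g z / (1 - z)\<close> vanishing at 0, all estimates compare
  derivatives along a ray. Put \<open>a = |f 0|\<close> and \<open>c = phi 1 r\<close>. By Schwarz--Pick the integrand for
  \<open>|cesaro f z| + c * |cesaro (deriv f) z|\<close> is at most \<open>(u + c (1 - u\<^sup>2) / (1 - t\<^sup>2)) / (1 - t)\<close> with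
  \<open>u = |f|\<close>, which for \<open>r \<le> R\<close> increases in \<open>u\<close>, so that \<open>u\<close> may be replaced by its maximum
  \<open>(a + t) / (1 + a t)\<close>. The excess over \<open>1 / (1 - t)\<close>, together with the coefficient bound
  \<open>|a\<^sub>k| \<le> 1 - a\<^sup>2\<close>, is \<open>1 - a\<close> times a quantity that is largest at \<open>a = 1\<close>, where it integrates to
  \<open>r * radius_lhs r\<close>. Sharpness follows from \<open>f z = (z + a) / (1 + a z)\<close> on the positive axis as
  \<open>a\<close> tends to 1.
\<close>

section \<open>Schwarz--Pick inequalities and the Cesaro operator\<close>

lemma cnj_mult_self: "cnj w * w = of_real ((cmod w)\<^sup>2)"
  by (metis complex_norm_square mult.commute)

text \<open>Turns a bound on the pseudo-hyperbolic quotient \<open>|u - b| / |1 - cnj b * u|\<close>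
  into a bound on its denominator.\<close>

lemma norm_diff_Moebius:
  "(cmod (1 - cnj b * u))\<^sup>2 - (cmod (u - b))\<^sup>2 = (1 - (cmod b)\<^sup>2) * (1 - (cmod u)\<^sup>2)"
  by (simp only: cmod_power2) (simp add: power2_eq_square algebra_simps)

text \<open>Disc automorphisms before and after \<open>f\<close> yield a self-map of the disc that
  fixes 0, to which the Schwarz lemma applies. Its derivative part, centred at \<open>w\<close>,
  gives the first claim; its growth part, centred at 0, gives the second. Strictness makes the
  values of \<open>f\<close> admissible parameters of automorphisms.\<close>

lemma Schwarz_Pick_strict:
  assumes hol: "f holomorphic_on ball 0 1"
    and lt1: "\<And>z. cmod z < 1 \<Longrightarrow> cmod (f z) < 1" and w: "cmod w < 1"
  shows "cmod (deriv f w) * (1 - (cmod w)\<^sup>2) \<le> 1 - (cmod (f w))\<^sup>2"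
    and "cmod (f w) * (1 + cmod (f 0) * cmod w) \<le> cmod (f 0) + cmod w"
proof -
  define M where "M = Moebius_function 0"
  define G where "G = (\<lambda>v \<zeta>. M (f v) (f (M (- v) \<zeta>)))"
  have M_less: "cmod (M v \<zeta>) < 1" if "cmod v < 1" "cmod \<zeta> < 1" for v \<zeta>
    unfolding M_def using that by (rule Moebius_function_norm_lt_1)
  have M_hol: "M v holomorphic_on ball 0 1" if "cmod v < 1" for v
    unfolding M_def using that by (rule Moebius_function_holomorphic)
  have M_neg0: "M (- v) 0 = v" for v
    by (simp add: M_def Moebius_function_simple)
  have M_self: "M v v = 0" for v
    by (simp add: M_def Moebius_function_eq_zero)
  have G_hol: "G v holomorphic_on ball 0 1" if v: "cmod v < 1" for v
  proof -
    have "(f \<circ> M (- v)) holomorphic_on ball 0 1"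
      by (rule holomorphic_on_compose_gen[OF M_hol hol]) (use v M_less[of "- v"] in auto)
    then have "(M (f v) \<circ> (f \<circ> M (- v))) holomorphic_on ball 0 1"
      by (rule holomorphic_on_compose_gen[OF _ M_hol])
        (use v lt1 M_less[of "- v"] in auto)
    then show ?thesis by (simp add: G_def o_def)
  qed
  have G_less: "cmod (G v \<zeta>) < 1" if "cmod v < 1" "cmod \<zeta> < 1" for v \<zeta>
    unfolding G_def using that by (intro M_less lt1) auto
  have G0: "G v 0 = 0" for v
    by (simp add: G_def M_neg0 M_self)
  have sq: "(cmod v)\<^sup>2 < 1" if "cmod v < 1" for v :: complex
    using that by (simp add: power_less_one_iff)
  have M_deriv: "(M b has_field_derivative 1 / of_real (1 - (cmod b)\<^sup>2)) (at b)"
    if b: "cmod b < 1" for b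
  proof -
    have nz: "1 - cnj b * b \<noteq> 0"
      unfolding cnj_mult_self using sq[OF b] by (metis eq_iff_diff_eq_0 less_irrefl of_real_eq_1_iff)
    have "((\<lambda>z. (z - b) / (1 - cnj b * z)) has_field_derivative 1 / (1 - cnj b * b)) (at b)"
      using nz by (auto intro!: derivative_eq_intros simp: power2_eq_square)
    then show ?thesis
      by (simp add: M_def Moebius_function_simple[abs_def] cnj_mult_self)
  qed
  have M_neg_deriv: "(M (- b) has_field_derivative of_real (1 - (cmod b)\<^sup>2)) (at 0)" for b
  proof -
    have "((\<lambda>z. (z + b) / (1 + cnj b * z)) has_field_derivative 1 - cnj b * b) (at 0)"
      by (auto intro!: derivative_eq_intros simp: power2_eq_square)
    then show ?thesis
      by (simp add: M_def Moebius_function_simple[abs_def] cnj_mult_self)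
  qed
  have "(f has_field_derivative deriv f w) (at (M (- w) 0))"
    using holomorphic_derivI[OF hol open_ball] w by (simp add: M_neg0)
  from DERIV_chain2[OF this M_neg_deriv]
  have "((\<lambda>\<zeta>. f (M (- w) \<zeta>)) has_field_derivative deriv f w * of_real (1 - (cmod w)\<^sup>2)) (at 0)" .
  moreover have "(M (f w) has_field_derivative 1 / of_real (1 - (cmod (f w))\<^sup>2)) (at (f (M (- w) 0)))"
    using M_deriv[OF lt1[OF w]] by (simp add: M_neg0)
  ultimately have "(G w has_field_derivative
      1 / of_real (1 - (cmod (f w))\<^sup>2) * (deriv f w * of_real (1 - (cmod w)\<^sup>2))) (at 0)"
    unfolding G_def by (rule DERIV_chain2[rotated])
  then have "deriv (G w) 0 = 1 / of_real (1 - (cmod (f w))\<^sup>2) * (deriv f w * of_real (1 - (cmod w)\<^sup>2))"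
    by (rule DERIV_imp_deriv)
  moreover have "cmod (deriv (G w) 0) \<le> 1"
    by (rule Schwarz_Lemma(2)[OF G_hol[OF w] G0 G_less[OF w] w]) auto
  moreover have "cmod (1 / of_real (1 - (cmod (f w))\<^sup>2) * (deriv f w * of_real (1 - (cmod w)\<^sup>2)))
      = cmod (deriv f w) * (1 - (cmod w)\<^sup>2) / (1 - (cmod (f w))\<^sup>2)"
    using sq[OF w] sq[OF lt1[OF w]] by (simp only: norm_mult norm_divide norm_of_real norm_one) auto
  ultimately show "cmod (deriv f w) * (1 - (cmod w)\<^sup>2) \<le> 1 - (cmod (f w))\<^sup>2"
    using sq[OF lt1[OF w]] by (simp add: divide_le_eq)

  define a r u where "a = cmod (f 0)" and "r = cmod w" and "u = cmod (f w)"
  have a: "0 \<le> a" "a < 1" and r: "0 \<le> r" "r < 1" and u: "0 \<le> u" "u < 1"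
    using lt1[of 0] lt1[OF w] w by (auto simp: a_def r_def u_def)
  have "cmod (G 0 w) \<le> cmod w"
    by (rule Schwarz_Lemma(1)[OF G_hol G0 G_less]) (use w in auto)
  then have le: "cmod (f w - f 0) / cmod (1 - cnj (f 0) * f w) \<le> r"
    by (simp add: G_def M_def Moebius_function_simple norm_divide r_def)
  have au: "a * u < 1"
    using a u by (metis less_eq_real_def mult_less_cancel_left1 mult_le_less_imp_less mult.left_neutral mult_strict_mono zero_less_one mult_zero_left)
  have ge: "1 - a * u \<le> cmod (1 - cnj (f 0) * f w)"
    using norm_triangle_ineq2[of 1 "cnj (f 0) * f w"] by (simp add: norm_mult a_def u_def)
  have "cmod (f w - f 0) \<le> r * cmod (1 - cnj (f 0) * f w)"
    using le ge au by (simp add: divide_le_eq split: if_splits)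
  then have "(cmod (f w - f 0))\<^sup>2 \<le> r\<^sup>2 * (cmod (1 - cnj (f 0) * f w))\<^sup>2"
    by (metis norm_ge_zero power_mono power_mult_distrib)
  then have "(1 - r\<^sup>2) * (cmod (1 - cnj (f 0) * f w))\<^sup>2 \<le> (1 - a\<^sup>2) * (1 - u\<^sup>2)"
    using norm_diff_Moebius[of "f 0" "f w"] by (simp add: a_def u_def algebra_simps)
  \<comment> \<open>Passing to the smaller number \<open>1 - a * u\<close> leaves an inequality
    between moduli; the real identity \<open>(1 - a u)\<^sup>2 - (u - a)\<^sup>2 = (1 - a\<^sup>2)
    (1 - u\<^sup>2)\<close> then turns it back into a bound on \<open>u - a\<close>.\<close>
  moreover have "(1 - r\<^sup>2) * (1 - a * u)\<^sup>2 \<le> (1 - r\<^sup>2) * (cmod (1 - cnj (f 0) * f w))\<^sup>2"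
    using ge au r by (intro mult_left_mono power_mono) (auto simp: power_le_one)
  ultimately have "(1 - r\<^sup>2) * (1 - a * u)\<^sup>2 \<le> (1 - a\<^sup>2) * (1 - u\<^sup>2)"
    by linarith
  then have "(u - a)\<^sup>2 \<le> (r * (1 - a * u))\<^sup>2"
    by (simp add: power2_eq_square algebra_simps)
  then have "u - a \<le> r * (1 - a * u)"
    by (rule power2_le_imp_le) (use r au in auto)
  then show "cmod (f w) * (1 + cmod (f 0) * cmod w) \<le> cmod (f 0) + cmod w"
    by (simp add: a_def u_def r_def algebra_simps)
qed

text \<open>Since \<open>|f|\<close> may reach 1, the strict version is applied to
  \<open>t * f\<close> with \<open>0 < t < 1\<close>, and then \<open>t\<close> tends to 1.\<close>

lemma Schwarz_Pick:
  assumes hol: "f holomorphic_on ball 0 1"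
    and le1: "\<And>z. cmod z < 1 \<Longrightarrow> cmod (f z) \<le> 1" and w: "cmod w < 1"
  shows "cmod (deriv f w) * (1 - (cmod w)\<^sup>2) \<le> 1 - (cmod (f w))\<^sup>2"
    and "cmod (f w) * (1 + cmod (f 0) * cmod w) \<le> cmod (f 0) + cmod w"
proof -
  have strict: "t * cmod (deriv f w) * (1 - (cmod w)\<^sup>2) \<le> 1 - (t * cmod (f w))\<^sup>2 \<and>
     t * cmod (f w) * (1 + t * cmod (f 0) * cmod w) \<le> t * cmod (f 0) + cmod w"
    if t: "0 < t" "t < 1" for t
  proof -
    let ?g = "\<lambda>z. of_real t * f z"
    have g_hol: "?g holomorphic_on ball 0 1"
      by (intro holomorphic_intros hol)
    have g_less: "cmod (?g z) < 1" if "cmod z < 1" for z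
    proof -
      have "cmod (?g z) \<le> t * 1"
        unfolding norm_mult using t le1[OF that] by (simp add: mult_left_le)
      then show ?thesis using t by simp
    qed
    have "deriv ?g w = of_real t * deriv f w"
      by (rule deriv_cmult) (use hol w in \<open>auto intro: holomorphic_on_imp_differentiable_at\<close>)
    with Schwarz_Pick_strict[OF g_hol g_less w] t show ?thesis
      by (simp add: norm_mult)
  qed
  have ev: "eventually (\<lambda>t::real. t \<in> {0<..<1}) (at_left 1)"
    by (rule eventually_at_left_real) simp
  have "((\<lambda>t. t * cmod (deriv f w) * (1 - (cmod w)\<^sup>2)) \<longlongrightarrow> 1 * cmod (deriv f w) * (1 - (cmod w)\<^sup>2)) (at_left 1)"
    and "((\<lambda>t. 1 - (t * cmod (f w))\<^sup>2) \<longlongrightarrow> 1 - (1 * cmod (f w))\<^sup>2) (at_left 1)"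
    by (intro tendsto_intros)+
  from this(2,1) have "1 * cmod (deriv f w) * (1 - (cmod w)\<^sup>2) \<le> 1 - (1 * cmod (f w))\<^sup>2"
    by (rule tendsto_le[rotated]) (use ev strict in \<open>auto elim!: eventually_mono\<close>)
  then show "cmod (deriv f w) * (1 - (cmod w)\<^sup>2) \<le> 1 - (cmod (f w))\<^sup>2" by simp
  have "((\<lambda>t. t * cmod (f w) * (1 + t * cmod (f 0) * cmod w)) \<longlongrightarrow>
      1 * cmod (f w) * (1 + 1 * cmod (f 0) * cmod w)) (at_left 1)"
    and "((\<lambda>t. t * cmod (f 0) + cmod w) \<longlongrightarrow> 1 * cmod (f 0) + cmod w) (at_left 1)"
    by (intro tendsto_intros)+
  from this(2,1) have "1 * cmod (f w) * (1 + 1 * cmod (f 0) * cmod w) \<le> 1 * cmod (f 0) + cmod w"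
    by (rule tendsto_le[rotated]) (use ev strict in \<open>auto elim!: eventually_mono\<close>)
  then show "cmod (f w) * (1 + cmod (f 0) * cmod w) \<le> cmod (f 0) + cmod w" by simp
qed

section \<open>Coefficients of bounded power series\<close>

lemma powser_coeff_eq:
  assumes "\<And>z. cmod z < 1 \<Longrightarrow> (\<lambda>n. a n * z ^ n) sums f z"
  shows "a n = taylor_coeff f n"
proof -
  have "eventually (\<lambda>z. z \<in> ball (0::complex) 1) (nhds 0)"
    by (rule eventually_nhds_in_open) auto
  then have "f has_fps_expansion Abs_fps a"
    by (intro has_fps_expansionI) (use assms in \<open>auto elim!: eventually_mono\<close>)
  from fps_nth_fps_expansion[OF this, of n] show ?thesis
    by (simp add: taylor_coeff_def)
qed

text \<open>The roots-of-unity filter: unless the ratio is 1, the sum is geometric and its ratio has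
  \<open>k\<close>-th power 1.\<close>

lemma sum_powers_root_unity:
  assumes k: "0 < k"
  shows "(\<Sum>j<k. (cis (2 * pi * real n / real k)) ^ j) = (if k dvd n then of_nat k else 0)"
proof -
  let ?x = "cis (2 * pi * real n / real k)"
  have pow: "?x ^ k = 1"
  proof -
    have "real k * (2 * pi * real n / real k) = 2 * pi * real n" using k by simp
    then have "?x ^ k = cis (2 * pi * real n)" by (simp only: Complex.DeMoivre)
    then show ?thesis by (simp add: cis_multiple_2pi)
  qed
  have iff: "?x = 1 \<longleftrightarrow> k dvd n"
  proof
    assume "?x = 1"
    then have "cos (2 * pi * real n / real k) = 1"
      by (metis Re_complex_of_real cis.sel(1) of_real_1)
    then obtain m :: int where "2 * pi * real n / real k = of_int m * 2 * pi"
      by (auto simp: cos_one_2pi_int)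
    with k have "real n = of_int m * real k" by (simp add: field_simps)
    then have "int n = m * int k"
      by (metis of_int_eq_iff of_int_mult of_int_of_nat_eq)
    then show "k dvd n" by (metis dvd_triv_right int_dvd_int_iff)
  next
    assume "k dvd n"
    then obtain m where "n = k * m" by auto
    then have "2 * pi * real n / real k = 2 * pi * real m" using k by simp
    then show "?x = 1" by (simp add: cis_multiple_2pi)
  qed
  show ?thesis
  proof (cases "k dvd n")
    case True
    with iff have "?x = 1" by blast
    then show ?thesis using True by simp
  next
    case False
    with iff have "?x \<noteq> 1" by blast
    then show ?thesis using False by (subst geometric_sum) (auto simp: pow)
  qed
qed

text \<open>Averaging \<open>f\<close> over rotations by \<open>k\<close>-th roots of unity leaves a function of \<open>z ^ k\<close> in the
  unit ball whose first two coefficients are \<open>a 0\<close> and \<open>a k\<close>; this reduces to \<open>k = 1\<close>.\<close>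

lemma norm_coeff_le:
  assumes sums: "\<And>z. cmod z < 1 \<Longrightarrow> (\<lambda>n. a n * z ^ n) sums f z"
    and le1: "\<And>z. cmod z < 1 \<Longrightarrow> cmod (f z) \<le> 1" and k: "0 < k"
  shows "cmod (a k) \<le> 1 - (cmod (a 0))\<^sup>2"
proof -
  define \<omega> where "\<omega> = cis (2 * pi / real k)"
  have \<omega>_pow: "\<omega> ^ n = cis (2 * pi * real n / real k)" for n
    unfolding \<omega>_def Complex.DeMoivre by (rule arg_cong[where f = cis]) simp
  have norm_\<omega>: "cmod (\<omega> ^ j * z) = cmod z" for j z
    by (simp add: \<omega>_def norm_mult norm_power)
  define h where "h w = (\<Sum>n. a (k * n) * w ^ n)" for w
  have *: "(\<lambda>n. a (k * n) * w ^ n) sums h w \<and> cmod (h w) \<le> 1" if w: "cmod w < 1" for w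
  proof -
    \<comment> \<open>\<open>h w\<close> is reached through a \<open>k\<close>-th root
      \<open>z\<close> of \<open>w\<close>: it is the mean of \<open>f\<close> over the
      \<open>k\<close> rotations of \<open>z\<close>, hence bounded by 1.\<close>
    obtain z where z: "w = z ^ k"
      using exists_complex_root[of k w] k by auto
    have z1: "cmod z < 1"
      using w k by (simp add: z norm_power power_less_one_iff)
    define S where "S = (\<Sum>j<k. f (\<omega> ^ j * z))"
    have "(\<lambda>n. \<Sum>j<k. a n * (\<omega> ^ j * z) ^ n) sums S"
      unfolding S_def by (intro sums_sum sums) (simp add: norm_\<omega> z1)
    moreover have "(\<Sum>j<k. a n * (\<omega> ^ j * z) ^ n) = (if k dvd n then of_nat k * a n * z ^ n else 0)"
      for n
    proof -
      have "(\<Sum>j<k. a n * (\<omega> ^ j * z) ^ n) = a n * z ^ n * (\<Sum>j<k. (\<omega> ^ n) ^ j)"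
        by (simp add: sum_distrib_left power_mult_distrib mult_ac flip: power_mult)
      then show ?thesis
        by (simp add: \<omega>_pow sum_powers_root_unity[OF k])
    qed
    ultimately have "(\<lambda>n. if k dvd n then of_nat k * a n * z ^ n else 0) sums S" by simp
    \<comment> \<open>All nonzero terms sit at multiples of \<open>k\<close>, so reindexing along
      them keeps the sum.\<close>
    then have "(\<lambda>n. (\<lambda>n. if k dvd n then of_nat k * a n * z ^ n else 0) (k * n)) sums S"
      by (subst sums_mono_reindex) (use k in \<open>auto simp: strict_mono_def image_iff dvd_def\<close>)
    then have "(\<lambda>n. (1 / of_nat k) * (of_nat k * a (k * n) * z ^ (k * n))) sums (1 / of_nat k * S)"
      by (intro sums_mult) simp
    then have sm: "(\<lambda>n. a (k * n) * w ^ n) sums (1 / of_nat k * S)"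
      using k by (simp add: z power_mult)
    moreover have "cmod S \<le> (\<Sum>j<k. 1)"
      unfolding S_def by (rule sum_norm_le) (simp add: le1 norm_\<omega> z1)
    then have "cmod (1 / of_nat k * S) \<le> 1"
      using k by (simp add: norm_mult norm_divide field_simps)
    ultimately show ?thesis
      unfolding h_def by (auto simp: sums_iff)
  qed
  have "h holomorphic_on ball 0 1"
    by (rule power_series_holomorphic[where a = "\<lambda>n. a (k * n)"]) (use * in auto)
  \<comment> \<open>At 0 the Schwarz--Pick inequality bounds the coefficient of \<open>w\<close> in
    \<open>h\<close>, which is \<open>a k\<close>.\<close>
  from Schwarz_Pick(1)[OF this, of 0] *
  have "cmod (deriv h 0) \<le> 1 - (cmod (h 0))\<^sup>2" by simp
  moreover have "deriv h 0 = a k"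
    using powser_coeff_eq[of "\<lambda>n. a (k * n)" h 1] * by (simp add: taylor_coeff_def)
  moreover have "h 0 = a 0"
    using powser_coeff_eq[of "\<lambda>n. a (k * n)" h 0] * by (simp add: taylor_coeff_def)
  ultimately show ?thesis by simp
qed

text \<open>The partial sums \<open>c n\<close> are the coefficients of
  \<open>g z / (1 - z)\<close>, by the Cauchy product with the geometric series; shifting the index
  and dividing by it integrates this series termwise.\<close>

lemma DERIV_mult_cesaro:
  assumes hol: "g holomorphic_on ball 0 1" and z: "cmod z < 1"
  shows "((\<lambda>z. z * cesaro g z) has_field_derivative g z / (1 - z)) (at z)"
proof -
  define c where "c n = (\<Sum>k\<le>n. taylor_coeff g k)" for n
  \<comment> \<open>Division by zero gives \<open>d 0 = 0\<close>, the constant term of a primitive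
    vanishing at 0.\<close>
  define d where "d n = c (n - 1) / of_nat n" for n
  have c_sums: "(\<lambda>n. c n * w ^ n) sums (g w / (1 - w))" if w: "cmod w < 1" for w
  proof -
    have tc: "(\<lambda>n. taylor_coeff g n * v ^ n) sums g v" if "cmod v < 1" for v
      using holomorphic_power_series[OF hol, of v] that by (simp add: taylor_coeff_def)
    \<comment> \<open>Convergence at the larger radius \<open>t\<close> gives absolute convergence
      at \<open>w\<close>.\<close>
    obtain t where t: "cmod w < t" "t < 1" using dense[OF w] by blast
    then have t0: "0 < t" by (meson norm_ge_zero order.strict_trans1)
    have abs1: "summable (\<lambda>n. norm (taylor_coeff g n * w ^ n))"
      by (rule powser_insidea[OF sums_summable[OF tc[of "of_real t"]]]) (use t t0 in auto)
    have abs2: "summable (\<lambda>n. norm (w ^ n))"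
      using w by (simp add: norm_power summable_geometric)
    from Cauchy_product_sums[OF abs1 abs2]
    have "(\<lambda>n. \<Sum>i\<le>n. taylor_coeff g i * w ^ i * w ^ (n - i)) sums (g w * (1 / (1 - w)))"
      using tc[OF w] geometric_sums[OF w] by (simp add: sums_iff)
    moreover have "(\<Sum>i\<le>n. taylor_coeff g i * w ^ i * w ^ (n - i)) = c n * w ^ n" for n
      unfolding c_def sum_distrib_right
      by (rule sum.cong) (auto simp: mult.assoc simp flip: power_add)
    ultimately show ?thesis by simp
  qed
  have d_Suc: "d (Suc n) * w ^ Suc n = w * (1 / of_nat (n + 1) * c n * w ^ n)" for n w
    by (simp add: d_def)
  have summ: "summable (\<lambda>n. 1 / of_nat (n + 1) * c n * w ^ n)" if w: "cmod w < 1" for w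
  proof -
    obtain t where t: "cmod w < t" "t < 1" using dense[OF w] by blast
    then have t0: "0 < t" by (meson norm_ge_zero order.strict_trans1)
    have abs1: "summable (\<lambda>n. norm (c n * w ^ n))"
      by (rule powser_insidea[OF sums_summable[OF c_sums[of "of_real t"]]]) (use t t0 in auto)
    show ?thesis
    proof (rule summable_comparison_test'[OF abs1])
      fix n :: nat
      have "cmod (1 / of_nat (n + 1) * c n * w ^ n) = cmod (c n * w ^ n) / real (n + 1)"
        by (simp only: norm_mult norm_divide norm_one norm_of_nat) simp
      also have "\<dots> \<le> cmod (c n * w ^ n)"
        by (simp add: divide_le_eq mult_left_le algebra_simps)
      finally show "cmod (1 / of_nat (n + 1) * c n * w ^ n) \<le> cmod (c n * w ^ n)" .
    qed
  qed
  have d_summable: "summable (\<lambda>n. d n * w ^ n)" if "cmod w < 1" for w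
    using summable_mult[OF summ[OF that], of w] by (subst summable_Suc_iff[symmetric]) (simp only: d_Suc)
  have eq: "w * cesaro g w = (\<Sum>n. d n * w ^ n)" if "cmod w < 1" for w
  proof -
    have "(\<Sum>n. d n * w ^ n) = (\<Sum>n. d (Suc n) * w ^ Suc n) + d 0 * w ^ 0"
      using suminf_split_head[OF d_summable[OF that]] by (simp add: algebra_simps)
    also have "\<dots> = (\<Sum>n. w * (1 / of_nat (n + 1) * c n * w ^ n))"
      by (simp only: d_Suc) (simp add: d_def)
    also have "\<dots> = w * cesaro g w"
      using suminf_mult[OF summ[OF that]] by (simp add: cesaro_def c_def)
    finally show ?thesis by simp
  qed
  have "((\<lambda>z. \<Sum>n. d n * z ^ n) has_field_derivative (\<Sum>n. diffs d n * z ^ n)) (at z)"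
    by (rule termdiffs_strong'[OF d_summable z])
  moreover have "diffs d n = c n" for n
    unfolding diffs_def d_def diff_Suc_1 by (metis nonzero_mult_div_cancel_left of_nat_neq_0 times_divide_eq_right)
  ultimately have "((\<lambda>z. \<Sum>n. d n * z ^ n) has_field_derivative g z / (1 - z)) (at z)"
    using c_sums[OF z] by (simp add: sums_iff)
  then show ?thesis
    by (rule has_field_derivative_transform_within_open[of _ _ _ "ball 0 1"])
      (use z eq in \<open>auto simp: dist_norm\<close>)
qed

section \<open>The functions \<open>phi k\<close> and their sums\<close>

text \<open>Stands in for monotonicity of the integral: integral estimates become comparisons of
  primitives that agree at 0.\<close>

lemma deriv_le_imp_le:
  fixes F G :: "real \<Rightarrow> real"
  assumes "0 \<le> r"
    and F: "\<And>x. 0 \<le> x \<Longrightarrow> x \<le> r \<Longrightarrow> (F has_real_derivative f x) (at x)"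
    and G: "\<And>x. 0 \<le> x \<Longrightarrow> x \<le> r \<Longrightarrow> (G has_real_derivative g x) (at x)"
    and le: "\<And>x. 0 \<le> x \<Longrightarrow> x \<le> r \<Longrightarrow> f x \<le> g x" and 0: "F 0 = G 0"
  shows "F r \<le> G r"
proof -
  have "G 0 - F 0 \<le> G r - F r"
  proof (rule DERIV_nonneg_imp_nondecreasing[where f = "\<lambda>x. G x - F x"])
    fix x assume "0 \<le> x" "x \<le> r"
    then show "\<exists>y. ((\<lambda>x. G x - F x) has_real_derivative y) (at x) \<and> 0 \<le> y"
      using DERIV_diff[OF G F, of x] le[of x] by (intro exI[of _ "g x - f x"]) auto
  qed fact
  with 0 show ?thesis by simp
qed

text \<open>The monotone form of l'Hospital's rule. By Cauchy's mean value theorem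
  \<open>F x / K x\<close> is a value of \<open>f / k\<close> on \<open>(0, x)\<close>, and the
  difference quotient over \<open>[x, y]\<close> is a value further right, hence larger; combining
  both raises the ratio.\<close>

lemma ratio_strict_mono:
  fixes F K :: "real \<Rightarrow> real"
  assumes xy: "0 < x" "x < y"
    and F: "\<And>t. 0 \<le> t \<Longrightarrow> t \<le> y \<Longrightarrow> (F has_real_derivative f t) (at t)"
    and K: "\<And>t. 0 \<le> t \<Longrightarrow> t \<le> y \<Longrightarrow> (K has_real_derivative k t) (at t)"
    and pos: "\<And>t. 0 < t \<Longrightarrow> t \<le> y \<Longrightarrow> 0 < k t"
    and mono: "\<And>s t. 0 < s \<Longrightarrow> s < t \<Longrightarrow> t \<le> y \<Longrightarrow> f s / k s < f t / k t"
    and 0: "F 0 = 0" "K 0 = 0"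
  shows "F x / K x < F y / K y"
proof -
  have cauchy: "\<exists>c. a < c \<and> c < b \<and> F b - F a = (K b - K a) * (f c / k c) \<and> K a < K b"
    if ab: "0 \<le> a" "a < b" "b \<le> y" for a b
  proof -
    have "\<exists>c. a < c \<and> c < b \<and> (F b - F a) * k c = (K b - K a) * f c"
      using ab by (intro GMVT') (auto intro!: F K DERIV_isCont)
    then obtain c where c: "a < c" "c < b" "(F b - F a) * k c = (K b - K a) * f c" by blast
    obtain z where z: "a < z" "z < b" "K b - K a = (b - a) * k z"
      using MVT2[of a b K k] ab K by auto
    have "0 < (b - a) * k z"
      using z ab pos[of z] by (intro mult_pos_pos) auto
    then have "K a < K b" using z by linarith
    with c pos[of c] ab show ?thesis
      by (intro exI[of _ c]) (auto simp: field_simps)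
  qed
  obtain c where c: "0 < c" "c < x" "F x = K x * (f c / k c)" "0 < K x"
    using cauchy[of 0 x] xy 0 by auto
  obtain d where d: "x < d" "d < y" "F y - F x = (K y - K x) * (f d / k d)" "K x < K y"
    using cauchy[of x y] xy by auto
  have "(K y - K x) * (f c / k c) < (K y - K x) * (f d / k d)"
    using mono[of c d] c d by (intro mult_strict_left_mono) auto
  then have "K y * (f c / k c) < F y"
    using c(3) d(3) left_diff_distrib[of "K y" "K x" "f c / k c"] by linarith
  moreover have "F x / K x = f c / k c" using c by simp
  ultimately show ?thesis
    using c(4) d(4) by (simp add: less_divide_eq mult.commute)
qed

section \<open>Closed forms and bounds for \<open>phi k\<close>\<close>

lemma summable_phi:
  assumes "\<bar>x\<bar> < 1"
  shows "summable (\<lambda>i. x ^ (k + i) / real (k + i + 1))"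
proof (rule summable_comparison_test'[of "\<lambda>i. \<bar>x\<bar> ^ i"])
  show "summable (\<lambda>i. \<bar>x\<bar> ^ i)" using assms by (intro summable_geometric) simp
  fix i :: nat
  have "\<bar>x\<bar> ^ (k + i) \<le> \<bar>x\<bar> ^ i" using assms by (intro power_decreasing) auto
  also have "\<dots> \<le> \<bar>x\<bar> ^ i * real (k + i + 1)" by (simp add: algebra_simps)
  finally show "norm (x ^ (k + i) / real (k + i + 1)) \<le> \<bar>x\<bar> ^ i"
    by (simp add: power_abs divide_le_eq)
qed

lemma mult_phi_eq:
  assumes "\<bar>x\<bar> < 1"
  shows "x * phi k x = - ln (1 - x) - (\<Sum>i<k. x ^ Suc i / real (Suc i))"
proof -
  have "(\<lambda>n. - (- (x ^ n) / real n)) sums (- ln (1 - x))"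
    using sums_minus[OF ln_series'[of "- x"]] assms by simp
  then have "(\<lambda>n. x ^ n / real n) sums (- ln (1 - x))" by simp
  then have "(\<lambda>n. x ^ Suc n / real (Suc n)) sums (- ln (1 - x))"
    using sums_Suc_iff[of "\<lambda>n. x ^ n / real n" "- ln (1 - x)"] by simp
  from sums_split_initial_segment[OF this, of k]
  have "(\<lambda>i. x * (x ^ (k + i) / real (k + i + 1))) sums (- ln (1 - x) - (\<Sum>i<k. x ^ Suc i / real (Suc i)))"
    by (simp add: add_ac)
  moreover have "(\<lambda>i. x * (x ^ (k + i) / real (k + i + 1))) sums (x * phi k x)"
    unfolding phi_def by (intro sums_mult summable_sums summable_phi assms)
  ultimately show ?thesis by (rule sums_unique2[symmetric])
qed

lemma phi_nonneg: "0 \<le> x \<Longrightarrow> x < 1 \<Longrightarrow> 0 \<le> phi k x"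
  unfolding phi_def by (intro suminf_nonneg summable_phi) auto

lemma DERIV_mult_phi:
  assumes x: "\<bar>x\<bar> < 1"
  shows "((\<lambda>x. x * phi k x) has_real_derivative x ^ k / (1 - x)) (at x)"
proof -
  have "((\<lambda>x. - ln (1 - x) - (\<Sum>i<k. x ^ Suc i / real (Suc i))) has_real_derivative
      1 / (1 - x) - (\<Sum>i<k. real (Suc i) * x ^ i / real (Suc i))) (at x)"
    using x by (auto intro!: derivative_eq_intros simp del: power_Suc of_nat_Suc)
  also have "1 / (1 - x) - (\<Sum>i<k. real (Suc i) * x ^ i / real (Suc i)) = x ^ k / (1 - x)"
    using x by (simp add: sum_gp_strict diff_divide_distrib del: of_nat_Suc)
  finally show ?thesis
    by (rule has_field_derivative_transform_within_open[of _ _ _ "{-1<..<1}"])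
      (use x in \<open>auto simp: mult_phi_eq abs_less_iff simp del: power_Suc of_nat_Suc\<close>)
qed

text \<open>In closed form, \<open>phi_tail r = \<integral>\<^sub>0\<^sup>r x\<^sup>2 / (1 - x)\<^sup>2 dx = r * (\<Sum>k\<ge>2. phi k r)\<close>
  and \<open>deriv_part r = \<integral>\<^sub>0\<^sup>r 2 / ((1 + x)\<^sup>2 (1 - x)) dx\<close>.\<close>

definition phi_tail :: "real \<Rightarrow> real" where
  "phi_tail r = r + 2 * ln (1 - r) + r / (1 - r)"

definition deriv_part :: "real \<Rightarrow> real" where
  "deriv_part r = (- ln (1 - r) + ln (1 + r) + 2 * r / (1 + r)) / 2"

lemma DERIV_phi_tail:
  assumes "\<bar>x\<bar> < 1"
  shows "(phi_tail has_real_derivative x\<^sup>2 / (1 - x)\<^sup>2) (at x)"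
proof -
  have "((\<lambda>x. x + 2 * ln (1 - x) + x / (1 - x)) has_real_derivative
      1 - 2 / (1 - x) + ((1 - x) + x) / ((1 - x) * (1 - x))) (at x)"
    using assms by (auto intro!: derivative_eq_intros)
  also have "1 - 2 / (1 - x) + ((1 - x) + x) / ((1 - x) * (1 - x)) = x\<^sup>2 / (1 - x)\<^sup>2"
  proof -
    have "1 - x \<noteq> 0" using assms by auto
    then show ?thesis by (simp add: divide_simps) (simp add: algebra_simps power2_eq_square)
  qed
  finally show ?thesis by (simp add: phi_tail_def[abs_def])
qed

lemma DERIV_deriv_part:
  assumes "\<bar>x\<bar> < 1"
  shows "(deriv_part has_real_derivative 2 / ((1 + x)\<^sup>2 * (1 - x))) (at x)"
proof -
  have nz: "1 - x \<noteq> 0" "1 + x \<noteq> 0" "1 - x > 0" "1 + x > 0" using assms by auto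
  have "((\<lambda>x. (- ln (1 - x) + ln (1 + x) + 2 * x / (1 + x)) / 2) has_real_derivative
      (1 / (1 - x) + 1 / (1 + x) + (2 * (1 + x) - 2 * x) / ((1 + x) * (1 + x))) / 2) (at x)"
    using nz by (auto intro!: derivative_eq_intros)
  also have "(1 / (1 - x) + 1 / (1 + x) + (2 * (1 + x) - 2 * x) / ((1 + x) * (1 + x))) / 2
      = 2 / ((1 + x)\<^sup>2 * (1 - x))"
    using nz by (simp add: divide_simps) (simp add: algebra_simps power2_eq_square)
  finally show ?thesis by (simp add: deriv_part_def[abs_def])
qed

lemma phi_tail_0: "phi_tail 0 = 0" and deriv_part_0: "deriv_part 0 = 0"
  by (simp_all add: phi_tail_def deriv_part_def)

lemma deriv_part_strict_mono:
  assumes "0 \<le> x" "x < y" "y < 1"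
  shows "deriv_part x < deriv_part y"
proof (rule DERIV_pos_imp_increasing[OF assms(2)])
  fix t assume "x \<le> t" "t \<le> y"
  with assms show "\<exists>z. (deriv_part has_real_derivative z) (at t) \<and> 0 < z"
    by (intro exI[of _ "2 / ((1 + t)\<^sup>2 * (1 - t))"] conjI DERIV_deriv_part) auto
qed

text \<open>The finite sum has derivative \<open>1 - x ^ N\<close> times that of
  \<open>phi_tail\<close>, and this factor lies between \<open>1 - r ^ N\<close> and 1. The upper
  bound serves the inequality, the lower one its sharpness.\<close>

lemma sum_phi_bounds:
  assumes r: "0 \<le> r" "r < 1"
  shows "r * (\<Sum>k<N. phi (k + 2) r) \<le> phi_tail r"
    and "(1 - r ^ N) * phi_tail r \<le> r * (\<Sum>k<N. phi (k + 2) r)"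
proof -
  let ?T = "\<lambda>x. \<Sum>k<N. x * phi (k + 2) x"
  have T: "(?T has_real_derivative (1 - x ^ N) * (x\<^sup>2 / (1 - x)\<^sup>2)) (at x)" if "0 \<le> x" "x \<le> r" for x
  proof -
    have "(?T has_real_derivative (\<Sum>k<N. x ^ (k + 2) / (1 - x))) (at x)"
      using that r by (intro DERIV_sum DERIV_mult_phi) auto
    also have "(\<Sum>k<N. x ^ (k + 2) / (1 - x)) = x\<^sup>2 / (1 - x) * (\<Sum>k<N. x ^ k)"
      by (simp add: sum_distrib_left power_add mult_ac power2_eq_square flip: sum_divide_distrib)
    also have "\<dots> = (1 - x ^ N) * (x\<^sup>2 / (1 - x)\<^sup>2)"
      using that r by (simp add: sum_gp_strict power2_eq_square)
    finally show ?thesis .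
  qed
  have S: "(phi_tail has_real_derivative x\<^sup>2 / (1 - x)\<^sup>2) (at x)" if "0 \<le> x" "x \<le> r" for x
    using that r by (intro DERIV_phi_tail) auto
  have "?T r \<le> phi_tail r"
  proof (rule deriv_le_imp_le[OF r(1) T S])
    fix x assume "0 \<le> x" "x \<le> r"
    then show "(1 - x ^ N) * (x\<^sup>2 / (1 - x)\<^sup>2) \<le> x\<^sup>2 / (1 - x)\<^sup>2"
      using r by (intro mult_left_le_one_le) (auto simp: power_le_one)
  qed (simp_all add: phi_tail_0)
  then show "r * (\<Sum>k<N. phi (k + 2) r) \<le> phi_tail r" by (simp add: sum_distrib_left)
  have "(1 - r ^ N) * phi_tail r \<le> ?T r"
  proof (rule deriv_le_imp_le[OF r(1) DERIV_cmult[OF S] T])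
    fix x assume "0 \<le> x" "x \<le> r"
    then show "(1 - r ^ N) * (x\<^sup>2 / (1 - x)\<^sup>2) \<le> (1 - x ^ N) * (x\<^sup>2 / (1 - x)\<^sup>2)"
      using r by (intro mult_right_mono) (auto simp: power_mono)
  qed (simp_all add: phi_tail_0)
  then show "(1 - r ^ N) * phi_tail r \<le> r * (\<Sum>k<N. phi (k + 2) r)" by (simp add: sum_distrib_left)
qed

lemma phi_1_eq: "0 < r \<Longrightarrow> r < 1 \<Longrightarrow> phi 1 r = (- r - ln (1 - r)) / r"
  using mult_phi_eq[of r 1] by (simp add: field_simps)

text \<open>Splits the expression defining \<open>r1\<close> into the quantities that the estimates
  of the three terms of the inequality produce.\<close>

lemma mult_radius_lhs:
  assumes "0 < r" "r < 1"
  shows "r * radius_lhs r = - ln (1 + r) + phi 1 r * deriv_part r + 2 * phi_tail r"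
proof -
  have nz: "r \<noteq> 0" "1 - r \<noteq> 0" "1 + r \<noteq> 0" using assms by auto
  have "r * (- (1 / r) * ln (1 + r)) = - ln (1 + r)" using nz by simp
  moreover have "r * ((- r - ln (1 - r)) / (2 * r)
      * (- (1 / r) * ln (1 - r) + 1 / r * ln (1 + r) + 2 / (1 + r))) = phi 1 r * deriv_part r"
    unfolding phi_1_eq[OF assms] deriv_part_def using nz by (simp add: divide_simps)
  moreover have "r * (2 * (r\<^sup>2 / (1 - r) + r + 2 + 2 / r * ln (1 - r))) = 2 * phi_tail r"
    using nz by (simp add: phi_tail_def divide_simps) (simp add: algebra_simps power2_eq_square)
  ultimately show ?thesis
    unfolding radius_lhs_def by (simp only: distrib_left)
qed

section \<open>The defining equations of the radii\<close>

text \<open>After division by \<open>r\<close> each summand is a quotient increasing by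
  \<open>ratio_strict_mono\<close>, or a product of two nonnegative increasing factors.\<close>

lemma radius_lhs_strict_mono:
  assumes xy: "0 < x" "x < y" "y < 1"
  shows "radius_lhs x < radius_lhs y"
proof -
  \<comment> \<open>Both factors \<open>1 / r\<close> go to the logarithm and none to
    \<open>deriv_part r\<close>, because \<open>deriv_part r / r\<close> decreases near 0.\<close>
  have split: "radius_lhs r = - ln (1 + r) / r + (- r - ln (1 - r)) / r\<^sup>2 * deriv_part r + 2 * (phi_tail r / r)"
    if "0 < r" "r < 1" for r
  proof -
    have "radius_lhs r = r * radius_lhs r / r" using that by simp
    also have "\<dots> = (- ln (1 + r) + (- r - ln (1 - r)) / r * deriv_part r + 2 * phi_tail r) / r"
      unfolding mult_radius_lhs[OF that] phi_1_eq[OF that] ..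
    finally show ?thesis
      unfolding add_divide_distrib power2_eq_square by simp
  qed
  have "- ln (1 + x) / x < - ln (1 + y) / y"
    by (rule ratio_strict_mono[OF xy(1,2), where F = "\<lambda>t. - ln (1 + t)"
          and f = "\<lambda>t. - 1 / (1 + t)" and K = "\<lambda>t. t" and k = "\<lambda>_. 1"])
      (auto intro!: derivative_eq_intros simp: divide_simps)
  moreover have "phi_tail x / x < phi_tail y / y"
  proof (rule ratio_strict_mono[OF xy(1,2), where F = phi_tail
        and f = "\<lambda>t. t\<^sup>2 / (1 - t)\<^sup>2" and K = "\<lambda>t. t" and k = "\<lambda>_. 1"])
    fix s t :: real assume st: "0 < s" "s < t" "t \<le> y"
    then have "s / (1 - s) < t / (1 - t)" using xy by (simp add: divide_simps algebra_simps)
    then have "(s / (1 - s))\<^sup>2 < (t / (1 - t))\<^sup>2" using st xy by (intro power_strict_mono) auto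
    then show "s\<^sup>2 / (1 - s)\<^sup>2 / 1 < t\<^sup>2 / (1 - t)\<^sup>2 / 1" by (simp only: power_divide div_by_1)
  next
    show "(phi_tail has_real_derivative t\<^sup>2 / (1 - t)\<^sup>2) (at t)" if "0 \<le> t" "t \<le> y" for t
      using that xy by (intro DERIV_phi_tail) auto
  qed (simp_all add: phi_tail_0)
  moreover have "(- x - ln (1 - x)) / x\<^sup>2 * deriv_part x < (- y - ln (1 - y)) / y\<^sup>2 * deriv_part y"
  proof (rule mult_strict_mono)
    show "(- x - ln (1 - x)) / x\<^sup>2 < (- y - ln (1 - y)) / y\<^sup>2"
    proof (rule ratio_strict_mono[OF xy(1,2), where F = "\<lambda>t. - t - ln (1 - t)"
          and f = "\<lambda>t. t / (1 - t)" and K = "\<lambda>t. t\<^sup>2" and k = "\<lambda>t. 2 * t"])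
      fix t assume "0 \<le> t" "t \<le> y"
      then show "((\<lambda>t. - t - ln (1 - t)) has_real_derivative t / (1 - t)) (at t)"
        using xy by (auto intro!: derivative_eq_intros simp: field_simps)
    next
      fix s t :: real assume st: "0 < s" "s < t" "t \<le> y"
      have "s / (1 - s) / (2 * s) = 1 / (2 * (1 - s))" "t / (1 - t) / (2 * t) = 1 / (2 * (1 - t))"
        using st by simp_all
      then show "s / (1 - s) / (2 * s) < t / (1 - t) / (2 * t)"
        using st xy by (simp add: frac_less2)
    qed (auto intro!: derivative_eq_intros)
    show "deriv_part x < deriv_part y" using xy by (intro deriv_part_strict_mono) auto
    have "0 \<le> - y - ln (1 - y)" using ln_le_minus_one[of "1 - y"] xy by simp
    moreover have "- x - ln (1 - x) \<ge> 0" using ln_le_minus_one[of "1 - x"] xy by simp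
    moreover show "0 \<le> deriv_part x" using deriv_part_strict_mono[of 0 x] xy deriv_part_0 by simp
    ultimately show "0 < (- y - ln (1 - y)) / y\<^sup>2"
      using \<open>(- x - ln (1 - x)) / x\<^sup>2 < (- y - ln (1 - y)) / y\<^sup>2\<close>
      by (smt (verit) divide_nonneg_nonneg zero_le_power2)
  qed
  ultimately show ?thesis using split[of x] split[of y] xy by linarith
qed

text \<open>The difference of the two sides of the equation for \<open>R\<close>, divided by
  \<open>r\<close>. For \<open>0 < r < 1\<close>, negativity means
  \<open>2 * phi 1 r < 1 - r\<^sup>2\<close>, the condition behind the monotonicity in
  \<open>u\<close>.\<close>

definition R_fun :: "real \<Rightarrow> real" where
  "R_fun r = 2 * ((- r - ln (1 - r)) / r) + r\<^sup>2 - 1"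

lemma R_fun_sign:
  "R_fun r < 0 \<longleftrightarrow> (- r - ln (1 - r)) / r < (1 - r\<^sup>2) / 2"
  "0 < R_fun r \<longleftrightarrow> (1 - r\<^sup>2) / 2 < (- r - ln (1 - r)) / r"
proof -
  have "2 * q + c - 1 < 0 \<longleftrightarrow> q < (1 - c) / 2" "0 < 2 * q + c - 1 \<longleftrightarrow> (1 - c) / 2 < q" for q c :: real
    by auto
  then show "R_fun r < 0 \<longleftrightarrow> (- r - ln (1 - r)) / r < (1 - r\<^sup>2) / 2"
    and "0 < R_fun r \<longleftrightarrow> (1 - r\<^sup>2) / 2 < (- r - ln (1 - r)) / r"
    unfolding R_fun_def by blast+
qed

lemma R_fun_strict_mono:
  assumes xy: "0 < x" "x < y" "y < 1"
  shows "R_fun x < R_fun y"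
proof -
  have "(- x - ln (1 - x)) / x < (- y - ln (1 - y)) / y"
  proof (rule ratio_strict_mono[OF xy(1,2), where F = "\<lambda>t. - t - ln (1 - t)"
        and f = "\<lambda>t. t / (1 - t)" and K = "\<lambda>t. t" and k = "\<lambda>t. 1"])
    fix t assume "0 \<le> t" "t \<le> y"
    then show "((\<lambda>t. - t - ln (1 - t)) has_real_derivative t / (1 - t)) (at t)"
      using xy by (auto intro!: derivative_eq_intros simp: field_simps)
  next
    fix s t :: real assume "0 < s" "s < t" "t \<le> y"
    then show "s / (1 - s) / 1 < t / (1 - t) / 1"
      using xy by (simp add: divide_simps algebra_simps)
  qed auto
  moreover have "x\<^sup>2 < y\<^sup>2" using xy by (intro power_strict_mono) auto
  moreover have "p < q \<Longrightarrow> c < d \<Longrightarrow> 2 * p + c - 1 < 2 * q + d - 1" for p q c d :: real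
    by linarith
  ultimately show ?thesis unfolding R_fun_def by blast
qed

lemma R_fun_eq_0_iff:
  assumes "0 < r"
  shows "R_fun r = 0 \<longleftrightarrow> 2 * (- r - ln (1 - r)) = r * (1 - r\<^sup>2)"
  using assms by (auto simp: R_fun_def field_simps)

text \<open>The arguments are fractions with small denominators, just above \<open>1 / (1 - 0.4934105)\<close> and
  just below \<open>1 / (1 - 0.4934115)\<close>.\<close>

lemma ln_bounds: "ln (8119 / 4113 :: real) \<le> 0.68005438" "0.6800556 \<le> ln (683 / 346 :: real)"
proof -
  \<comment> \<open>\<open>y = (x - 1) / (x + 1)\<close> is the variable of the series
    \<open>ln x = 2 * (\<Sum>k. y ^ (2 k + 1) / (2 k + 1))\<close>; seven terms are precise enough,
    with a remainder added for the upper bound.\<close>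
  have "(8119 / 4113 - 1) / (8119 / 4113 + 1) = (2003 / 6116 :: real)" by simp
  then have "ln (8119 / 4113 :: real) \<le> (\<Sum>k<7. 2 * (2003 / 6116) ^ (2 * k + 1) / of_nat (2 * k + 1))
    + 2 * ((2003 / 6116) ^ (2 * 7 + 1) / (1 - (2003 / 6116)\<^sup>2) / of_nat (2 * 7 + 1))"
    using ln_approx_bounds[of "8119 / 4113" 7] by (simp only: atLeastAtMost_iff)
  also have "\<dots> \<le> 0.68005438"
    by (simp add: lessThan_nat_numeral power_divide)
  finally show "ln (8119 / 4113 :: real) \<le> 0.68005438" .
  have "(683 / 346 - 1) / (683 / 346 + 1) = (337 / 1029 :: real)" by simp
  then have "(\<Sum>k<7. 2 * (337 / 1029) ^ (2 * k + 1) / of_nat (2 * k + 1)) \<le> ln (683 / 346 :: real)"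
    using ln_approx_bounds[of "683 / 346" 7] by (simp only: atLeastAtMost_iff)
  moreover have "0.6800556 \<le> (\<Sum>k<7. 2 * (337 / 1029) ^ (2 * k + 1) / of_nat (2 * k + 1) :: real)"
    by (simp add: lessThan_nat_numeral power_divide)
  ultimately show "0.6800556 \<le> ln (683 / 346 :: real)" by simp
qed

text \<open>The end points lie 0.0000005 on either side of 0.493411, so a sign change between them
  gives the stated accuracy of \<open>R\<close>.\<close>

lemma R_fun_bracket: "R_fun 0.4934105 < 0" "0 < R_fun 0.4934115"
proof -
  have ln_eq: "ln (1 - x) = - ln (1 / (1 - x))" if "x < 1" for x :: real
    using that by (simp add: ln_div)
  have "ln (1 / (1 - 0.4934105)) \<le> ln (8119 / 4113 :: real)"
    by (subst ln_le_cancel_iff) simp_all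
  from order_trans[OF this ln_bounds(1)] have lo: "- ln (1 - 0.4934105) \<le> (0.68005438 :: real)"
    using ln_eq[of "0.4934105"] by simp
  have "(- 0.4934105 - ln (1 - 0.4934105)) / 0.4934105 \<le> (0.68005438 - 0.4934105) / (0.4934105 :: real)"
    using lo by (intro divide_right_mono) auto
  also have "\<dots> < (1 - 0.4934105\<^sup>2) / 2"
    by (simp add: power2_eq_square)
  finally show "R_fun 0.4934105 < 0" unfolding R_fun_sign .
  have "ln (683 / 346 :: real) \<le> ln (1 / (1 - 0.4934115))"
    by (subst ln_le_cancel_iff) simp_all
  from order_trans[OF ln_bounds(2) this] have hi: "(0.6800556 :: real) \<le> - ln (1 - 0.4934115)"
    using ln_eq[of "0.4934115"] by simp
  have "(1 - 0.4934115\<^sup>2) / 2 < (0.6800556 - 0.4934115) / (0.4934115 :: real)"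
    by (simp add: power2_eq_square)
  also have "\<dots> \<le> (- 0.4934115 - ln (1 - 0.4934115)) / 0.4934115"
    using hi by (intro divide_right_mono) auto
  finally show "0 < R_fun 0.4934115" unfolding R_fun_sign .
qed

lemma R_root:
  obtains R where "0.4934105 < R" "R < 0.4934115" "R_fun R = 0"
    "\<And>r. 0 < r \<Longrightarrow> r < 1 \<Longrightarrow> R_fun r = 0 \<Longrightarrow> r = R"
proof -
  have "\<exists>R\<ge>0.4934105. R \<le> 0.4934115 \<and> R_fun R = 0"
    using R_fun_bracket by (intro IVT') (auto simp: R_fun_def[abs_def] intro!: continuous_intros)
  then obtain R where R: "0.4934105 \<le> R" "R \<le> 0.4934115" "R_fun R = 0" by blast
  show thesis
  proof (rule that[of R])
    show "0.4934105 < R" "R < 0.4934115"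
      using R R_fun_bracket by (smt (verit))+
    show "r = R" if "0 < r" "r < 1" "R_fun r = 0" for r
      using R_fun_strict_mono[of r R] R_fun_strict_mono[of R r] R that by fastforce
  qed fact
qed

text \<open>This places \<open>r1\<close> below \<open>R\<close>. The equation for \<open>R\<close>
  eliminates \<open>ln (1 - R)\<close>; what remains is rational in \<open>R\<close> apart from
  \<open>ln (1 + R) / R\<close>, and rough numerical bounds suffice.\<close>

lemma radius_lhs_R_pos:
  assumes R: "0.49 \<le> R" "R \<le> 0.5" and eq: "R_fun R = 0"
  shows "0 < radius_lhs R"
proof -
  define u where "u = 1 - R\<^sup>2"
  have R0: "0 < R" "R < 1" using R by auto
  have "2 * q + c - 1 = 0 \<Longrightarrow> q = (1 - c) / 2" for q c :: real by simp
  from this[OF eq[unfolded R_fun_def]] have E: "(- R - ln (1 - R)) / R = u / 2" by (simp only: R_fun_def u_def)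
  then have L: "ln (1 - R) / R = - 1 - u / 2" using R0 by (simp add: field_simps)
  have M: "ln (1 + R) / R \<le> 1" using ln_add_one_self_le_self[of R] R0 by simp
  have u: "0.75 \<le> u" "u \<le> 0.76"
    using power_mono[of R "0.5" 2] power_mono[of "0.49" R 2] R by (simp_all add: u_def power2_eq_square)
  have "radius_lhs R = - (ln (1 + R) / R) + (- R - ln (1 - R)) / R / 2 * (- (ln (1 - R) / R) + ln (1 + R) / R + 2 / (1 + R))
      + 2 * (R\<^sup>2 / (1 - R) + R + 2 + 2 * (ln (1 - R) / R))"
    by (simp add: radius_lhs_def)
  also have "\<dots> = - (ln (1 + R) / R) + u / 4 * (1 + u / 2 + ln (1 + R) / R + 2 / (1 + R))
      + 2 * (R\<^sup>2 / (1 - R) + R + 2 - 2 - u)"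
    unfolding E L by simp
  also have "\<dots> = (u / 4 - 1) * (ln (1 + R) / R) + u / 4 * (1 + u / 2 + 2 / (1 + R))
      + 2 * (R\<^sup>2 / (1 - R) + R - u)"
    by (simp add: algebra_simps)
  finally have eq2: "radius_lhs R = \<dots>" .
  \<comment> \<open>The coefficient \<open>u / 4 - 1\<close> is negative, so an upper bound for the
    logarithm is what is needed.\<close>
  have "(u / 4 - 1) * 1 \<le> (u / 4 - 1) * (ln (1 + R) / R)"
    using M u by (intro mult_left_mono_neg) auto
  moreover have "4 / 3 \<le> 2 / (1 + R)" using R by (simp add: field_simps)
  then have "0.75 / 4 * (1 + 0.75 / 2 + 4 / 3) \<le> u / 4 * (1 + u / 2 + 2 / (1 + R))"
    using u by (intro mult_mono) auto
  moreover have "0.47 \<le> R\<^sup>2 / (1 - R)"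
  proof -
    have "0.49 * 0.49 \<le> R\<^sup>2" unfolding power2_eq_square using R by (intro mult_mono) auto
    then show ?thesis using R0 R by (simp add: le_divide_eq)
  qed
  moreover have "0 < A + B + 2 * (C + R - u)"
    if "(u / 4 - 1) * 1 \<le> A" "0.75 / 4 * (1 + 0.75 / 2 + 4 / 3) \<le> B" "0.47 \<le> C" for A B C :: real
    using that u R by simp
  ultimately show ?thesis unfolding eq2 by blast
qed

text \<open>The expression tends to -1 at 0 from the right and is positive at \<open>R\<close>, so
  it changes sign in between.\<close>

lemma radius_lhs_root:
  assumes R: "0 < R" "R < 1" "0 < radius_lhs R"
  obtains r1 where "0 < r1" "r1 < R" "radius_lhs r1 = 0"
proof -
  have "(radius_lhs \<longlongrightarrow> - 1) (at_right 0)"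
    unfolding radius_lhs_def by real_asymp
  then have "eventually (\<lambda>x. radius_lhs x < 0) (at_right 0)"
    by (rule order_tendstoD) simp
  moreover have "eventually (\<lambda>x::real. x \<in> {0<..<R}) (at_right 0)"
    by (rule eventually_at_right_real) (use R in simp)
  ultimately have "eventually (\<lambda>x. radius_lhs x < 0 \<and> x \<in> {0<..<R}) (at_right 0)"
    by (rule eventually_conj)
  \<comment> \<open>The left end point must be positive: at 0 itself, division by zero makes
    \<open>radius_lhs 0 = 4\<close>.\<close>
  then obtain e where e: "radius_lhs e < 0" "0 < e" "e < R"
    using eventually_happens[of _ "at_right (0::real)"] by fastforce
  have "\<exists>x\<ge>e. x \<le> R \<and> radius_lhs x = 0"
    using e R by (intro IVT') (auto simp: radius_lhs_def[abs_def] intro!: continuous_intros)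
  then obtain x where x: "e \<le> x" "x \<le> R" "radius_lhs x = 0" by blast
  with e R that[of x] show thesis by (cases "x = R") auto
qed

section \<open>The upper bound\<close>

text \<open>Restricts the primitive to a ray and takes a real part, so that real comparison applies;
  a unimodular \<open>\<mu>\<close> can turn the modulus at one chosen point into this real
  part.\<close>

lemma DERIV_Re_cesaro_ray:
  assumes hol: "g holomorphic_on ball 0 1" and "cmod \<zeta> = 1" "0 \<le> t" "t < 1"
  shows "((\<lambda>t. Re (\<mu> * (of_real t * \<zeta> * cesaro g (of_real t * \<zeta>)))) has_real_derivative
     Re (\<mu> * (\<zeta> * g (of_real t * \<zeta>) / (1 - of_real t * \<zeta>)))) (at t)"
proof -
  have ray: "((\<lambda>t. of_real t * \<zeta>) has_vector_derivative \<zeta>) (at t)"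
    by (auto intro!: derivative_eq_intros)
  have "((\<lambda>z. z * cesaro g z) has_field_derivative g (of_real t * \<zeta>) / (1 - of_real t * \<zeta>)) (at (of_real t * \<zeta>))"
    using assms by (intro DERIV_mult_cesaro) (auto simp: norm_mult)
  from field_vector_diff_chain_at[OF ray this]
  have "((\<lambda>t. of_real t * \<zeta> * cesaro g (of_real t * \<zeta>)) has_vector_derivative
      \<zeta> * (g (of_real t * \<zeta>) / (1 - of_real t * \<zeta>))) (at t)" by (simp add: o_def)
  from has_field_derivative_Re[OF has_vector_derivative_mult_right[OF this]]
  show ?thesis by simp
qed

lemma unimodular_rotation: "\<exists>\<mu>. cmod \<mu> = 1 \<and> \<mu> * v = of_real (cmod v)"
proof (cases "v = 0")
  case True
  then show ?thesis by (intro exI[of _ 1]) simp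
next
  case False
  then show ?thesis by (intro exI[of _ "of_real (cmod v) / v"]) (simp add: norm_divide)
qed

text \<open>The excess per factor \<open>1 - a\<close> is largest at \<open>a = 1\<close>. The
  difference of the sides is a nonnegative multiple of \<open>x * p * q + d * N\<close>, affine in
  \<open>d\<close>; it is nonnegative at \<open>d = 0\<close> and, since
  \<open>2 * x * p + N = 1 - x\<^sup>2\<close>, also at \<open>d = q / 2\<close>. The bound on
  \<open>c\<close> says exactly that \<open>d \<le> q / 2\<close>.\<close>

lemma majorant_mono:
  fixes a x c :: real
  assumes a: "0 \<le> a" "a \<le> 1" and x: "0 \<le> x" "x \<le> 1 / 2" and c: "0 \<le> c" "2 * c \<le> 1 - x\<^sup>2"
  shows "- 1 / (1 + a * x) + c * (1 + a) / ((1 + a * x)\<^sup>2 * (1 - x))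
    \<le> - 1 / (1 + x) + c * (2 / ((1 + x)\<^sup>2 * (1 - x)))"
proof -
  define p q d N where "p = 1 + a * x" and "q = 1 + x" and "d = c / (1 - x)"
    and "N = (1 + x) * (1 - 3 * x) + 2 * (1 - a) * x\<^sup>2"
  have p: "1 \<le> p" and q: "1 \<le> q" using a x by (auto simp: p_def q_def)
  have d: "0 \<le> d" "d \<le> q / 2"
    using c x by (auto simp: d_def q_def field_simps power2_eq_square)
  have "0 \<le> x * p * q + d * N"
  proof (cases "0 \<le> N")
    case True
    then show ?thesis using x p q d by simp
  next
    case False
    have "2 * x * p + N = 1 - 3 * x\<^sup>2 + 2 * a * x\<^sup>2 + 2 * (1 - a) * x\<^sup>2"
      by (simp add: p_def N_def algebra_simps power2_eq_square)
    moreover have "x\<^sup>2 \<le> (1 / 2)\<^sup>2" using x by (intro power_mono) auto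
    ultimately have "0 \<le> 2 * x * p + N" using a by (simp add: power2_eq_square)
    then have "0 \<le> q / 2 * (2 * x * p + N)" using q by simp
    also have "\<dots> = x * p * q + q / 2 * N" by (simp add: algebra_simps)
    also have "\<dots> \<le> x * p * q + d * N"
      using d False by (intro add_left_mono mult_right_mono_neg) auto
    finally show ?thesis .
  qed
  then have "0 \<le> (1 - a) * (x * p * q + d * N) / (p\<^sup>2 * q\<^sup>2)"
    using a p q by simp
  also have "\<dots> = (1 - a) * x / (p * q) + d * ((1 - a) * N / (p\<^sup>2 * q\<^sup>2))"
    using p q by (simp add: field_simps power2_eq_square)
  also have "(1 - a) * x / (p * q) = 1 / p - 1 / q"
    using p q by (simp add: diff_frac_eq) (simp add: p_def q_def algebra_simps)
  also have "(1 - a) * N / (p\<^sup>2 * q\<^sup>2) = 2 / q\<^sup>2 - (1 + a) / p\<^sup>2"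
    using p q by (simp add: diff_frac_eq mult.commute)
      (simp add: p_def q_def N_def algebra_simps power2_eq_square)
  finally have "- (1 / p) + d * ((1 + a) / p\<^sup>2) \<le> - (1 / q) + d * (2 / q\<^sup>2)"
    by (simp add: algebra_simps)
  then show ?thesis by (simp add: p_def q_def d_def field_simps)
qed

text \<open>The map \<open>u \<mapsto> u + c (1 - u\<^sup>2) / (1 - t\<^sup>2)\<close> increases on \<open>[0, 1]\<close> because
  \<open>2 c \<le> 1 - t\<^sup>2\<close>; this is what the equation for \<open>R\<close> guarantees.\<close>

lemma Schwarz_Pick_combined:
  fixes u v a t c :: real
  assumes a: "0 \<le> a" "a \<le> 1" and t: "0 \<le> t" "t < 1" and c: "0 \<le> c" "2 * c \<le> 1 - t\<^sup>2"
    and v: "v * (1 - t\<^sup>2) \<le> 1 - u\<^sup>2" and u: "0 \<le> u" "u * (1 + a * t) \<le> a + t"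
  shows "u + c * v \<le> (a + t) / (1 + a * t) + c * (1 - a\<^sup>2) / (1 + a * t)\<^sup>2"
proof -
  define U e where "U = (a + t) / (1 + a * t)" and "e = c / (1 - t\<^sup>2)"
  have t2: "0 < 1 - t\<^sup>2" using t by (simp add: power_less_one_iff)
  have p: "1 \<le> 1 + a * t" using a t by simp
  have "0 \<le> (1 - a) * (1 - t)" using a t by simp
  then have U: "U \<le> 1" using p by (simp add: U_def divide_le_eq algebra_simps)
  have uU: "u \<le> U" using u p by (simp add: U_def le_divide_eq)
  have e: "0 \<le> e" "e \<le> 1 / 2" using c t2 by (simp_all add: e_def divide_le_eq)
  have "c * v = e * (v * (1 - t\<^sup>2))" using t2 by (simp add: e_def)
  also have "\<dots> \<le> e * (1 - u\<^sup>2)" using v e by (intro mult_left_mono)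
  finally have "u + c * v \<le> u + e * (1 - u\<^sup>2)" by simp
  also have "\<dots> \<le> U + e * (1 - U\<^sup>2)"
  proof -
    have "e * (U + u) \<le> 1 / 2 * 2" using e U uU u by (intro mult_mono) auto
    then have "0 \<le> (U - u) * (1 - e * (U + u))" using uU by simp
    then show ?thesis by (simp add: algebra_simps power2_eq_square)
  qed
  \<comment> \<open>By \<open>(1 + a t)\<^sup>2 - (a + t)\<^sup>2 = (1 - a\<^sup>2) (1 -
    t\<^sup>2)\<close>; the factor \<open>1 - t\<^sup>2\<close> then cancels against the denominator
    of \<open>e\<close>.\<close>
  also have "1 - U\<^sup>2 = (1 - a\<^sup>2) * (1 - t\<^sup>2) / (1 + a * t)\<^sup>2"
    using p by (simp add: U_def power_divide divide_simps) (simp add: algebra_simps power2_eq_square)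
  also have "e * \<dots> = c * (1 - a\<^sup>2) / (1 + a * t)\<^sup>2"
    using t2 by (simp add: e_def)
  finally show ?thesis by (simp add: U_def)
qed

text \<open>The weight \<open>c\<close> stays fixed along the ray from 0 to \<open>z\<close>, so the
  end value \<open>phi 1 (cmod z)\<close> may later be put in for it while derivatives are compared
  at every \<open>t \<le> cmod z\<close>.\<close>

lemma cesaro_deriv_bound:
  assumes hol: "f holomorphic_on ball 0 1" and le1: "\<And>z. cmod z < 1 \<Longrightarrow> cmod (f z) \<le> 1"
    and r: "0 < cmod z" "cmod z \<le> 1 / 2" and c: "0 \<le> c" "2 * c \<le> 1 - (cmod z)\<^sup>2"
  shows "cmod z * (cmod (cesaro f z) + c * cmod (cesaro (deriv f) z))
    \<le> - ln (1 - cmod z) + (1 - cmod (f 0)) * (- ln (1 + cmod z) + c * deriv_part (cmod z))"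
proof -
  define r a \<zeta> where "r = cmod z" and "a = cmod (f 0)" and "\<zeta> = z / of_real (cmod z)"
  have \<zeta>: "cmod \<zeta> = 1" "of_real r * \<zeta> = z"
    using r by (auto simp: \<zeta>_def r_def norm_divide)
  have a: "0 \<le> a" "a \<le> 1" using le1[of 0] by (auto simp: a_def)
  have hol': "deriv f holomorphic_on ball 0 1" by (rule holomorphic_deriv[OF hol open_ball])
  \<comment> \<open>The rotations are chosen at the end point \<open>z\<close>, where they make
    \<open>F\<close> the exact combination of moduli; before it, a real part is merely bounded by a
    modulus.\<close>
  obtain \<mu> where \<mu>: "cmod \<mu> = 1" "\<mu> * (z * cesaro f z) = of_real (cmod (z * cesaro f z))"
    using unimodular_rotation by blast
  obtain \<nu> where \<nu>: "cmod \<nu> = 1" "\<nu> * (z * cesaro (deriv f) z) = of_real (cmod (z * cesaro (deriv f) z))"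
    using unimodular_rotation by blast
  define F where "F t = Re (\<mu> * (of_real t * \<zeta> * cesaro f (of_real t * \<zeta>)))
    + c * Re (\<nu> * (of_real t * \<zeta> * cesaro (deriv f) (of_real t * \<zeta>)))" for t
  define \<Phi> where "\<Phi> t = - ln (1 - t) + (1 - a) * (- ln (1 + t) + c * deriv_part t)" for t
  define F' where "F' t = Re (\<mu> * (\<zeta> * f (of_real t * \<zeta>) / (1 - of_real t * \<zeta>)))
    + c * Re (\<nu> * (\<zeta> * deriv f (of_real t * \<zeta>) / (1 - of_real t * \<zeta>)))" for t
  define \<Phi>' where "\<Phi>' t = 1 / (1 - t) + (1 - a) * (- 1 / (1 + t) + c * (2 / ((1 + t)\<^sup>2 * (1 - t))))" for t
  have "F r \<le> \<Phi> r"
  proof (rule deriv_le_imp_le[of r F F' \<Phi> \<Phi>'])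
    show "0 \<le> r" by (simp add: r_def)
  next
    fix t assume t: "0 \<le> t" "t \<le> r"
    then have t1: "t \<le> 1 / 2" "t < 1" using r by (auto simp: r_def)
    show "(F has_real_derivative F' t) (at t)"
      unfolding F_def[abs_def] F'_def using t t1 \<zeta>
      by (intro DERIV_add DERIV_cmult DERIV_Re_cesaro_ray hol hol') auto
    have "((\<lambda>t. - ln (1 + t)) has_real_derivative - 1 / (1 + t)) (at t)"
      and "((\<lambda>t. - ln (1 - t)) has_real_derivative 1 / (1 - t)) (at t)"
      using t t1 by (auto intro!: derivative_eq_intros)
    then show "(\<Phi> has_real_derivative \<Phi>' t) (at t)"
      unfolding \<Phi>_def[abs_def] \<Phi>'_def using t t1
      by (intro DERIV_add DERIV_cmult DERIV_deriv_part) auto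
    define w where "w = of_real t * \<zeta>"
    have w: "cmod w = t" using t \<zeta> by (simp add: w_def norm_mult)
    have w1: "1 - t \<le> cmod (1 - w)" using norm_triangle_ineq2[of 1 w] w by simp
    have Re_le: "Re (\<kappa> * (\<zeta> * y / (1 - w))) \<le> cmod y / (1 - t)" if "cmod \<kappa> = 1" for \<kappa> y
    proof -
      have "Re (\<kappa> * (\<zeta> * y / (1 - w))) \<le> cmod (\<kappa> * (\<zeta> * y / (1 - w)))"
        by (rule complex_Re_le_cmod)
      also have "\<dots> = cmod y / cmod (1 - w)" using that \<zeta> by (simp add: norm_mult norm_divide)
      also have "\<dots> \<le> cmod y / (1 - t)" using w1 t1 by (intro divide_left_mono) (auto intro!: mult_pos_pos)
      finally show ?thesis .
    qed
    \<comment> \<open>The condition on \<open>c\<close> at the end point is the strongest one on the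
      ray.\<close>
    have t2: "t\<^sup>2 \<le> r\<^sup>2" using t by (intro power_mono) auto
    with c have ct: "2 * c \<le> 1 - t\<^sup>2" by (simp add: r_def)
    have p: "1 \<le> 1 + a * t" using a t by simp
    have "F' t \<le> cmod (f w) / (1 - t) + c * (cmod (deriv f w) / (1 - t))"
      unfolding F'_def w_def[symmetric] using Re_le \<mu>(1) \<nu>(1) c by (intro add_mono mult_left_mono) auto
    also have "\<dots> = (cmod (f w) + c * cmod (deriv f w)) / (1 - t)"
      by (simp add: add_divide_distrib)
    also have "\<dots> \<le> ((a + t) / (1 + a * t) + c * (1 - a\<^sup>2) / (1 + a * t)\<^sup>2) / (1 - t)"
    proof (intro divide_right_mono Schwarz_Pick_combined[where t = t])
      show "cmod (deriv f w) * (1 - t\<^sup>2) \<le> 1 - (cmod (f w))\<^sup>2"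
        using Schwarz_Pick(1)[OF hol le1, of w] w t1 by simp
      show "cmod (f w) * (1 + a * t) \<le> a + t"
        using Schwarz_Pick(2)[OF hol le1, of w] w t1 by (simp add: a_def)
    qed (use a t t1 c ct in auto)
    \<comment> \<open>Uses \<open>a + t = (1 + a t) - (1 - a) (1 - t)\<close> to separate the
      majorant \<open>1 / (1 - t)\<close> from the excess.\<close>
    also have "\<dots> = 1 / (1 - t) + (1 - a) * (- 1 / (1 + a * t) + c * (1 + a) / ((1 + a * t)\<^sup>2 * (1 - t)))"
      using p t1 by (simp add: divide_simps) (simp add: algebra_simps power2_eq_square)
    also have "\<dots> \<le> \<Phi>' t"
      unfolding \<Phi>'_def using a t t1 c ct
      by (intro add_left_mono mult_left_mono majorant_mono) auto
    finally show "F' t \<le> \<Phi>' t" .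
  next
    show "F 0 = \<Phi> 0" by (simp add: F_def \<Phi>_def deriv_part_0)
  qed
  moreover have "F r = r * (cmod (cesaro f z) + c * cmod (cesaro (deriv f) z))"
    unfolding F_def \<zeta> \<mu>(2) \<nu>(2) by (simp add: norm_mult r_def algebra_simps)
  ultimately show ?thesis by (simp add: \<Phi>_def r_def a_def)
qed

text \<open>The closed form bounds every partial sum of nonnegative terms, which yields summability
  and the estimate together.\<close>

lemma coeff_phi_sum_bound:
  assumes b: "\<And>k. 0 \<le> b k" "\<And>k. b k \<le> B" and r: "0 < r" "r < 1"
  shows "summable (\<lambda>k. b k * phi (k + 2) r)" and "r * (\<Sum>k. b k * phi (k + 2) r) \<le> B * phi_tail r"
proof -
  have B: "0 \<le> B" using b[of 0] by linarith
  have nonneg: "0 \<le> b k * phi (k + 2) r" for k using b r by (simp add: phi_nonneg)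
  have partial: "(\<Sum>k<N. b k * phi (k + 2) r) \<le> B * phi_tail r / r" for N
  proof -
    have "(\<Sum>k<N. b k * phi (k + 2) r) \<le> (\<Sum>k<N. B * phi (k + 2) r)"
      using b r by (intro sum_mono mult_right_mono phi_nonneg) auto
    also have "\<dots> = B * (r * (\<Sum>k<N. phi (k + 2) r)) / r"
      using r by (simp flip: sum_distrib_left)
    also have "\<dots> \<le> B * phi_tail r / r"
      using sum_phi_bounds(1)[of r N] r B by (intro divide_right_mono mult_left_mono) auto
    finally show ?thesis .
  qed
  show sm: "summable (\<lambda>k. b k * phi (k + 2) r)"
    by (rule summableI_nonneg_bounded[OF nonneg partial])
  show "r * (\<Sum>k. b k * phi (k + 2) r) \<le> B * phi_tail r"
    using suminf_le_const[OF sm partial] r by (simp add: le_divide_eq mult.commute)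
qed

section \<open>The inequality where \<open>radius_lhs\<close> is nonpositive\<close>

lemma phi_tail_nonneg: "0 \<le> r \<Longrightarrow> r < 1 \<Longrightarrow> 0 \<le> phi_tail r"
  using sum_phi_bounds(1)[of r 0] by simp

lemma mult_log_mean: "0 < r \<Longrightarrow> r < 1 \<Longrightarrow> r * log_mean r = - ln (1 - r)"
  by (simp add: log_mean_def ln_div)

lemma cesaro_at_0: "cesaro g 0 = g 0"
proof -
  have "cesaro g 0 = taylor_coeff g 0"
    unfolding cesaro_def using powser_zero[of "\<lambda>n. 1 / of_nat (n + 1) * (\<Sum>k\<le>n. taylor_coeff g k)"] by simp
  then show ?thesis by (simp add: taylor_coeff_def)
qed

text \<open>All estimates add up to \<open>(1 - \<alpha>) * (r * radius_lhs r)\<close> above the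
  right-hand side. The origin is separate, since \<open>radius_lhs 0\<close> is positive by
  convention; there the inequality reduces to \<open>|f 0| \<le> 1\<close>.\<close>

lemma cesaro_bohr_ineq_if_radius_lhs_nonpos:
  assumes f: "f \<in> bounded_class" and sums: "\<And>z. cmod z < 1 \<Longrightarrow> (\<lambda>n. a n * z ^ n) sums f z"
    and r: "cmod z \<le> 1 / 2" and phi1: "z \<noteq> 0 \<Longrightarrow> 2 * phi 1 (cmod z) \<le> 1 - (cmod z)\<^sup>2"
    and lhs: "z \<noteq> 0 \<Longrightarrow> radius_lhs (cmod z) \<le> 0"
  shows "cesaro_bohr_ineq f a z"
proof (cases "z = 0")
  case True
  have "cmod (f 0) \<le> 1" using f by (simp add: bounded_class_def)
  then show ?thesis
    using True by (simp add: cesaro_bohr_ineq_def cesaro_at_0 phi_at_0 log_mean_def)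
next
  case False
  have hol: "f holomorphic_on ball 0 1" and le1: "\<And>z. cmod z < 1 \<Longrightarrow> cmod (f z) \<le> 1"
    using f by (auto simp: bounded_class_def analytic_on_open)
  define r \<alpha> where "r = cmod z" and "\<alpha> = cmod (f 0)"
  have r: "0 < r" "r \<le> 1 / 2" "r < 1" using False r by (auto simp: r_def)
  have a0: "a 0 = f 0" using sums[of 0] by simp
  have \<alpha>: "0 \<le> \<alpha>" "\<alpha> \<le> 1" using le1[of 0] by (auto simp: \<alpha>_def)
  have "r * (\<Sum>k. cmod (a (k + 2)) * phi (k + 2) r) \<le> (1 - \<alpha>\<^sup>2) * phi_tail r"
    using norm_coeff_le[OF sums le1] r by (intro coeff_phi_sum_bound) (auto simp: \<alpha>_def a0)
  \<comment> \<open>Bounding \<open>1 + \<alpha>\<close> by 2 exposes the common factor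
    \<open>1 - \<alpha>\<close> and costs nothing in the limit \<open>\<alpha> = 1\<close>.\<close>
  also have "\<dots> \<le> (1 - \<alpha>) * (2 * phi_tail r)"
  proof -
    have "1 - \<alpha>\<^sup>2 \<le> 2 * (1 - \<alpha>)" using zero_le_power2[of "1 - \<alpha>"] by (simp add: power2_eq_square algebra_simps)
    from mult_right_mono[OF this phi_tail_nonneg[of r]] r show ?thesis by (simp add: mult_ac)
  qed
  finally have tail: "r * (\<Sum>k. cmod (a (k + 2)) * phi (k + 2) r) \<le> (1 - \<alpha>) * (2 * phi_tail r)" .
  have "r * (cmod (cesaro f z) + phi 1 r * cmod (cesaro (deriv f) z))
      \<le> - ln (1 - r) + (1 - \<alpha>) * (- ln (1 + r) + phi 1 r * deriv_part r)"
    unfolding r_def \<alpha>_def using r phi1 False phi_nonneg[of r 1]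
    by (intro cesaro_deriv_bound hol le1) (auto simp: r_def)
  with tail have "r * (cmod (cesaro f z) + cmod (cesaro (deriv f) z) * phi 1 r
      + (\<Sum>k. cmod (a (k + 2)) * phi (k + 2) r))
    \<le> - ln (1 - r) + (1 - \<alpha>) * (r * radius_lhs r)"
    unfolding mult_radius_lhs[OF r(1,3)] by (simp add: algebra_simps)
  also have "\<dots> \<le> r * log_mean r"
    using lhs False \<alpha> r by (simp add: mult_log_mean mult_nonneg_nonpos r_def)
  finally show ?thesis
    using r by (simp add: cesaro_bohr_ineq_def r_def)
qed

section \<open>Sharpness\<close>

text \<open>The Taylor coefficients at 0 of \<open>(z + a) / (1 + a z)\<close>.\<close>

definition moebius_coeff :: "real \<Rightarrow> nat \<Rightarrow> complex" where
  "moebius_coeff a n = (if n = 0 then of_real a else of_real ((1 - a\<^sup>2) * (- a) ^ (n - 1)))"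

locale extremal =
  fixes a :: real
  assumes a: "0 < a" "a < 1"
begin

definition f :: "complex \<Rightarrow> complex" where
  "f z = (z + of_real a) / (1 + of_real a * z)"

lemma denom_nz:
  assumes "cmod z < 1"
  shows "1 + of_real a * z \<noteq> 0"
proof
  assume "1 + of_real a * z = 0"
  then have "cmod (of_real a * z) = 1" by (metis add_eq_0_iff2 norm_minus_cancel norm_one)
  moreover have "a * cmod z < 1 * 1" using a assms by (intro mult_strict_mono) auto
  ultimately show False using a by (simp add: norm_mult)
qed

lemma hol: "f holomorphic_on ball 0 1"
  unfolding f_def[abs_def] using denom_nz by (intro holomorphic_intros) auto

lemma bounded: "f \<in> bounded_class"
proof -
  have "cmod (f z) < 1" if "cmod z < 1" for z
    using Moebius_function_norm_lt_1[of "- of_real a" z 0] a that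
    by (simp add: Moebius_function_simple f_def)
  then show ?thesis
    using hol by (auto simp: bounded_class_def analytic_on_open intro: less_imp_le)
qed

lemma sums:
  assumes z: "cmod z < 1"
  shows "(\<lambda>n. moebius_coeff a n * z ^ n) sums f z"
proof -
  have "cmod (- of_real a * z) < 1"
    using mult_strict_mono[of a 1 "cmod z" 1] a z by (simp add: norm_mult)
  have Suc_eq: "moebius_coeff a (Suc n) * z ^ Suc n = (1 - of_real a ^ 2) * z * (- of_real a * z) ^ n" for n
    by (simp only: power_mult_distrib) (simp add: moebius_coeff_def mult_ac)
  from sums_mult[OF geometric_sums[OF \<open>cmod (- of_real a * z) < 1\<close>], of "(1 - of_real a ^ 2) * z"]
  have "(\<lambda>n. moebius_coeff a (Suc n) * z ^ Suc n) sums ((1 - of_real a ^ 2) * z / (1 + of_real a * z))"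
    by (simp only: Suc_eq) simp
  then have "(\<lambda>n. moebius_coeff a n * z ^ n) sums ((1 - of_real a ^ 2) * z / (1 + of_real a * z) + of_real a)"
    by (subst (asm) sums_Suc_iff) (simp add: moebius_coeff_def)
  moreover have "(1 - of_real a ^ 2) * z / (1 + of_real a * z) + of_real a = f z"
    using denom_nz[OF z] by (simp add: f_def field_simps power2_eq_square)
  ultimately show ?thesis by simp
qed

lemma deriv_of_real:
  assumes "0 \<le> x" "x < 1"
  shows "deriv f (of_real x) = of_real ((1 - a\<^sup>2) / (1 + a * x)\<^sup>2)"
proof (rule DERIV_imp_deriv)
  have nz: "1 + complex_of_real a * of_real x \<noteq> 0" using denom_nz[of "of_real x"] assms by simp
  have "(f has_field_derivative (1 - of_real a ^ 2) / (1 + of_real a * of_real x)\<^sup>2) (at (of_real x))"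
    unfolding f_def[abs_def] using nz
    by (auto intro!: derivative_eq_intros simp: divide_simps) (simp_all add: algebra_simps power2_eq_square)
  then show "(f has_field_derivative of_real ((1 - a\<^sup>2) / (1 + a * x)\<^sup>2)) (at (of_real x))" by simp
qed

text \<open>The integrand is exactly \<open>1 / (1 - x) - (1 - a) / (1 + a x)\<close>. By
  \<open>a (1 + x) \<le> 1 + a x\<close> the second term is at most \<open>1 / a\<close> times
  \<open>(1 - a) / (1 + x)\<close>, a loss that disappears as \<open>a\<close> tends to 1.\<close>

lemma cesaro_lower:
  assumes r: "0 < r" "r < 1"
  shows "- ln (1 - r) - (1 - a) / a * ln (1 + r) \<le> r * cmod (cesaro f (of_real r))"
proof -
  \<comment> \<open>The factors 1 stand for \<open>\<mu>\<close> and \<open>\<zeta>\<close> of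
    \<open>DERIV_Re_cesaro_ray\<close>: the ray is the positive axis.\<close>
  have "- ln (1 - r) - (1 - a) / a * ln (1 + r) \<le> Re (1 * (of_real r * 1 * cesaro f (of_real r * 1)))"
  proof (rule deriv_le_imp_le[of r "\<lambda>x. - ln (1 - x) - (1 - a) / a * ln (1 + x)"
        "\<lambda>x. 1 / (1 - x) - (1 - a) / a * (1 / (1 + x))"
        "\<lambda>x. Re (1 * (of_real x * 1 * cesaro f (of_real x * 1)))"
        "\<lambda>x. Re (1 * (1 * f (of_real x * 1) / (1 - of_real x * 1)))"])
    fix x assume x: "0 \<le> x" "x \<le> r"
    then have x1: "x < 1" using r by simp
    show "((\<lambda>x. Re (1 * (of_real x * 1 * cesaro f (of_real x * 1)))) has_real_derivative
        Re (1 * (1 * f (of_real x * 1) / (1 - of_real x * 1)))) (at x)"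
      by (rule DERIV_Re_cesaro_ray[OF hol]) (use x x1 in auto)
    show "((\<lambda>x. - ln (1 - x) - (1 - a) / a * ln (1 + x)) has_real_derivative
        1 / (1 - x) - (1 - a) / a * (1 / (1 + x))) (at x)"
      using x x1 a by (auto intro!: derivative_eq_intros)
    have p: "0 < 1 + a * x" using a x by (simp add: add_pos_nonneg)
    have "f (of_real x * 1) / (1 - of_real x * 1) = of_real ((x + a) / (1 + a * x) / (1 - x))"
      by (simp add: f_def)
    then have "Re (1 * (1 * f (of_real x * 1) / (1 - of_real x * 1))) = (x + a) / (1 + a * x) / (1 - x)"
      by (simp only: mult_1_left Re_complex_of_real)
    also have "\<dots> = 1 / (1 - x) - (1 - a) / (1 + a * x)"
    proof -
      have "x + a = (1 + a * x) - (1 - a) * (1 - x)" by (simp add: algebra_simps)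
      then show ?thesis using p x1 by (simp add: diff_divide_distrib)
    qed
    finally have eq: "Re (1 * (1 * f (of_real x * 1) / (1 - of_real x * 1))) = 1 / (1 - x) - (1 - a) / (1 + a * x)" .
    have "(1 - a) / (1 + a * x) \<le> (1 - a) / (a * (1 + x))"
    proof (intro divide_left_mono mult_pos_pos)
      show "a * (1 + x) \<le> 1 + a * x" using a by (simp add: distrib_left)
    qed (use a x p in auto)
    moreover have "(1 - a) / (a * (1 + x)) = (1 - a) / a * (1 / (1 + x))" by simp
    ultimately show "1 / (1 - x) - (1 - a) / a * (1 / (1 + x))
        \<le> Re (1 * (1 * f (of_real x * 1) / (1 - of_real x * 1)))"
      unfolding eq by linarith
  qed (use r in auto)
  also have "\<dots> \<le> cmod (1 * (of_real r * 1 * cesaro f (of_real r * 1)))"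
    by (rule complex_Re_le_cmod)
  finally show ?thesis using r by (simp add: norm_mult)
qed

text \<open>Replacing \<open>a\<close> by 1 in the denominator of \<open>deriv f\<close> only lowers
  the integrand and leaves that of \<open>deriv_part\<close>.\<close>

lemma cesaro_deriv_lower:
  assumes r: "0 < r" "r < 1"
  shows "(1 - a\<^sup>2) / 2 * deriv_part r \<le> r * cmod (cesaro (deriv f) (of_real r))"
proof -
  have "(1 - a\<^sup>2) / 2 * deriv_part r \<le> Re (1 * (of_real r * 1 * cesaro (deriv f) (of_real r * 1)))"
  proof (rule deriv_le_imp_le[of r "\<lambda>x. (1 - a\<^sup>2) / 2 * deriv_part x"
        "\<lambda>x. (1 - a\<^sup>2) / 2 * (2 / ((1 + x)\<^sup>2 * (1 - x)))"
        "\<lambda>x. Re (1 * (of_real x * 1 * cesaro (deriv f) (of_real x * 1)))"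
        "\<lambda>x. Re (1 * (1 * deriv f (of_real x * 1) / (1 - of_real x * 1)))"])
    fix x assume x: "0 \<le> x" "x \<le> r"
    then have x1: "x < 1" using r by simp
    show "((\<lambda>x. Re (1 * (of_real x * 1 * cesaro (deriv f) (of_real x * 1)))) has_real_derivative
        Re (1 * (1 * deriv f (of_real x * 1) / (1 - of_real x * 1)))) (at x)"
      by (rule DERIV_Re_cesaro_ray[OF holomorphic_deriv[OF hol]]) (use x x1 in auto)
    show "((\<lambda>x. (1 - a\<^sup>2) / 2 * deriv_part x) has_real_derivative
        (1 - a\<^sup>2) / 2 * (2 / ((1 + x)\<^sup>2 * (1 - x)))) (at x)"
      using x x1 by (intro DERIV_cmult DERIV_deriv_part) auto
    have p: "0 < 1 + a * x" using a x by (simp add: add_pos_nonneg)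
    have "deriv f (of_real x * 1) / (1 - of_real x * 1) = of_real ((1 - a\<^sup>2) / (1 + a * x)\<^sup>2 / (1 - x))"
      using x x1 by (simp add: deriv_of_real)
    then have eq: "Re (1 * (1 * deriv f (of_real x * 1) / (1 - of_real x * 1))) = (1 - a\<^sup>2) / ((1 + a * x)\<^sup>2 * (1 - x))"
      by (simp only: mult_1_left Re_complex_of_real divide_divide_eq_left)
    have half: "y / 2 * (2 / z) = y / z" for y z :: real by simp
    have "a * x \<le> 1 * x" using a x by (intro mult_right_mono) auto
    then have "(1 + a * x)\<^sup>2 * (1 - x) \<le> (1 + x)\<^sup>2 * (1 - x)"
      using a x p x1 by (intro mult_right_mono power_mono) auto
    then have "(1 - a\<^sup>2) / ((1 + x)\<^sup>2 * (1 - x)) \<le> (1 - a\<^sup>2) / ((1 + a * x)\<^sup>2 * (1 - x))"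
      using a x p x1 by (intro divide_left_mono mult_pos_pos) (auto simp: power_le_one)
    then show "(1 - a\<^sup>2) / 2 * (2 / ((1 + x)\<^sup>2 * (1 - x)))
        \<le> Re (1 * (1 * deriv f (of_real x * 1) / (1 - of_real x * 1)))"
      unfolding eq half .
  qed (use r deriv_part_0 in auto)
  also have "\<dots> \<le> cmod (1 * (of_real r * 1 * cesaro (deriv f) (of_real r * 1)))"
    by (rule complex_Re_le_cmod)
  finally show ?thesis using r by (simp add: norm_mult)
qed

text \<open>Keeping \<open>N\<close> terms and bounding their powers of \<open>a\<close> below by
  \<open>a ^ N\<close> separates the limits in \<open>a\<close> and \<open>N\<close>.\<close>

lemma tail_lower:
  assumes r: "0 < r" "r < 1"
  shows "(1 - a\<^sup>2) * a ^ N * (1 - r ^ N) * phi_tail r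
    \<le> r * (\<Sum>k. cmod (moebius_coeff a (k + 2)) * phi (k + 2) r)"
proof -
  have a2: "0 \<le> 1 - a\<^sup>2" using a by (simp add: power_le_one)
  have norm_eq: "cmod (moebius_coeff a (k + 2)) = (1 - a\<^sup>2) * a ^ (k + 1)" for k
  proof -
    have "cmod (moebius_coeff a (k + 2)) = \<bar>(1 - a\<^sup>2) * (- a) ^ (k + 1)\<bar>"
      unfolding norm_of_real[where 'a = complex, symmetric] by (simp add: moebius_coeff_def)
    then show ?thesis using a a2 by (simp add: abs_mult power_abs)
  qed
  have le: "(1 - a\<^sup>2) * a ^ (k + 1) \<le> 1 * 1" for k
    using a a2 by (intro mult_mono power_le_one) auto
  have sm: "summable (\<lambda>k. cmod (moebius_coeff a (k + 2)) * phi (k + 2) r)"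
  proof (rule coeff_phi_sum_bound(1)[OF _ _ r])
    show "cmod (moebius_coeff a (k + 2)) \<le> 1" for k
      unfolding norm_eq using le[of k] by simp
  qed simp
  have "(1 - a\<^sup>2) * a ^ N * ((1 - r ^ N) * phi_tail r) \<le> (1 - a\<^sup>2) * a ^ N * (r * (\<Sum>k<N. phi (k + 2) r))"
    using sum_phi_bounds(2)[of r N] r a a2 by (intro mult_left_mono) auto
  also have "\<dots> = r * (\<Sum>k<N. (1 - a\<^sup>2) * a ^ N * phi (k + 2) r)"
    by (simp add: sum_distrib_left mult_ac)
  also have "\<dots> \<le> r * (\<Sum>k<N. cmod (moebius_coeff a (k + 2)) * phi (k + 2) r)"
    unfolding norm_eq using r a a2
    by (intro mult_left_mono sum_mono mult_right_mono power_decreasing phi_nonneg) auto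
  also have "\<dots> \<le> r * (\<Sum>k. cmod (moebius_coeff a (k + 2)) * phi (k + 2) r)"
    using r by (intro mult_left_mono sum_le_suminf sm) (auto simp: phi_nonneg)
  finally show ?thesis by (simp add: mult_ac)
qed

text \<open>With the lower bounds inserted, the terms \<open>- ln (1 - r)\<close> cancel and
  \<open>1 - a\<close> factors out; dividing by it leaves an expression continuous at
  \<open>a = 1\<close>.\<close>

lemma ineq_consequence:
  assumes r: "0 < r" "r < 1" and ineq: "cesaro_bohr_ineq f (moebius_coeff a) (of_real r)"
  shows "- (1 / a) * ln (1 + r) + (1 + a) / 2 * (phi 1 r * deriv_part r)
    + (1 + a) * a ^ N * (1 - r ^ N) * phi_tail r \<le> 0"
proof -
  have "r * (cmod (cesaro f (of_real r)) + cmod (cesaro (deriv f) (of_real r)) * phi 1 r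
      + (\<Sum>k. cmod (moebius_coeff a (k + 2)) * phi (k + 2) r)) \<le> r * log_mean r"
    using ineq r by (simp add: cesaro_bohr_ineq_def)
  moreover have "(1 - a\<^sup>2) / 2 * deriv_part r * phi 1 r \<le> r * cmod (cesaro (deriv f) (of_real r)) * phi 1 r"
    using cesaro_deriv_lower[OF r] r by (intro mult_right_mono phi_nonneg) auto
  ultimately have "- ((1 - a) / a * ln (1 + r)) + (1 - a\<^sup>2) / 2 * deriv_part r * phi 1 r
      + (1 - a\<^sup>2) * a ^ N * (1 - r ^ N) * phi_tail r \<le> 0"
    using cesaro_lower[OF r] tail_lower[OF r, of N] mult_log_mean[OF r]
    unfolding distrib_left mult.assoc[symmetric] by linarith
  moreover have "1 - a\<^sup>2 = (1 - a) * (1 + a)" by (simp add: power2_eq_square algebra_simps)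
  ultimately have "(1 - a) * (- (1 / a) * ln (1 + r) + (1 + a) / 2 * (phi 1 r * deriv_part r)
      + (1 + a) * a ^ N * (1 - r ^ N) * phi_tail r) \<le> 0"
    by (simp add: algebra_simps)
  then show ?thesis using a by (simp add: mult_le_0_iff)
qed

end

text \<open>The order of limits matters: first \<open>a\<close> tends to 1 with \<open>N\<close>
  fixed, so that \<open>a ^ N\<close> tends to 1, and then \<open>r ^ N\<close> tends to 0.\<close>

lemma radius_lhs_nonpos_if_ineq:
  assumes r: "0 < r" "r < 1"
    and ineq: "\<And>f a. f \<in> bounded_class \<Longrightarrow> (\<And>z. cmod z < 1 \<Longrightarrow> (\<lambda>n. a n * z ^ n) sums f z)
      \<Longrightarrow> cesaro_bohr_ineq f a (of_real r)"
  shows "radius_lhs r \<le> 0"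
proof -
  define L where "L N a = - (1 / a) * ln (1 + r) + (1 + a) / 2 * (phi 1 r * deriv_part r)
    + (1 + a) * a ^ N * (1 - r ^ N) * phi_tail r" for N a
  have L: "L N a \<le> 0" if "0 < a" "a < 1" for N a
  proof -
    interpret extremal a
      using that by unfold_locales
    show ?thesis unfolding L_def
      by (rule ineq_consequence[OF r ineq[OF bounded sums]])
  qed
  have L1: "L N 1 \<le> 0" for N
  proof (rule tendsto_upperbound)
    show "(L N \<longlongrightarrow> L N 1) (at_left 1)"
      unfolding L_def by (intro tendsto_intros) auto
    have "eventually (\<lambda>a::real. a \<in> {0<..<1}) (at_left 1)"
      by (rule eventually_at_left_real) simp
    then show "eventually (\<lambda>a. L N a \<le> 0) (at_left 1)"
      by eventually_elim (use L in auto)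
  qed simp
  have "(\<lambda>N. L N 1) \<longlonglongrightarrow> - (1 / 1) * ln (1 + r) + (1 + 1) / 2 * (phi 1 r * deriv_part r)
      + (1 + 1) * 1 * (1 - 0) * phi_tail r"
    unfolding L_def power_one using r by (intro tendsto_intros LIMSEQ_realpow_zero) auto
  then have "- (1 / 1) * ln (1 + r) + (1 + 1) / 2 * (phi 1 r * deriv_part r)
      + (1 + 1) * 1 * (1 - 0) * phi_tail r \<le> 0"
    by (rule LIMSEQ_le_const2) (use L1 in auto)
  then have "r * radius_lhs r \<le> 0"
    unfolding mult_radius_lhs[OF r] by simp
  then show ?thesis using r by (simp add: mult_le_0_iff)
qed

section \<open>Uniqueness of the radii, the inequality and its sharpness combined\<close>

theorem theorem2p1:
  shows "(\<exists>!R::real. 0 < R \<and> R < 1 \<and> 2 * (- R - ln (1 - R)) = R * (1 - R\<^sup>2))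
    \<and> (\<exists>!r1::real. 0 < r1 \<and> r1 < 1 \<and> radius_lhs r1 = 0)
    \<and> (\<forall>R r1::real.
          0 < R \<and> R < 1 \<and> 2 * (- R - ln (1 - R)) = R * (1 - R\<^sup>2)
          \<and> 0 < r1 \<and> r1 < 1 \<and> radius_lhs r1 = 0 \<longrightarrow>
            \<bar>R - 0.493411\<bar> \<le> 0.0000005
          \<and> r1 \<le> R
          \<and> (\<forall>f\<in>bounded_class. \<forall>a. (\<forall>z\<in>ball 0 1. (\<lambda>n. a n * z ^ n) sums f z) \<longrightarrow>
                (\<forall>z. cmod z \<le> r1 \<longrightarrow> cesaro_bohr_ineq f a z))
          \<and> (\<forall>\<rho>. r1 < \<rho> \<and> \<rho> < 1 \<longrightarrow>
                \<not> (\<forall>f\<in>bounded_class. \<forall>a. (\<forall>z\<in>ball 0 1. (\<lambda>n. a n * z ^ n) sums f z) \<longrightarrow>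
                      (\<forall>z. cmod z \<le> \<rho> \<longrightarrow> cesaro_bohr_ineq f a z))))"
proof -
  obtain R where R: "0.4934105 < R" "R < 0.4934115" "R_fun R = 0"
    and R_unique: "\<And>r. 0 < r \<Longrightarrow> r < 1 \<Longrightarrow> R_fun r = 0 \<Longrightarrow> r = R"
    using R_root by metis
  have R': "0 < R" "R < 1" using R by auto
  have "0 < radius_lhs R" using R by (intro radius_lhs_R_pos) auto
  then obtain r1 where r1: "0 < r1" "r1 < R" "radius_lhs r1 = 0"
    using radius_lhs_root[OF R'] by metis
  have r1_unique: "r = r1" if "0 < r" "r < 1" "radius_lhs r = 0" for r
    using radius_lhs_strict_mono[of r r1] radius_lhs_strict_mono[of r1 r] r1 R' that by fastforce
  \<comment> \<open>Uniqueness identifies any roots quantified in the statement with the two numbers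
    fixed here.\<close>
  have R_iff: "0 < S \<and> S < 1 \<and> 2 * (- S - ln (1 - S)) = S * (1 - S\<^sup>2) \<longleftrightarrow> S = R" for S
    using R_unique[of S] R_fun_eq_0_iff[of S] R R' by auto
  have r1_iff: "0 < s \<and> s < 1 \<and> radius_lhs s = 0 \<longleftrightarrow> s = r1" for s
    using r1_unique[of s] r1 R' by auto
  have upper: "cesaro_bohr_ineq f a z"
    if f: "f \<in> bounded_class" "\<forall>z\<in>ball 0 1. (\<lambda>n. a n * z ^ n) sums f z" and z: "cmod z \<le> r1" for f a z
  proof (rule cesaro_bohr_ineq_if_radius_lhs_nonpos[OF f(1)])
    show "cmod z \<le> 1 / 2" using z r1 R by simp
    show "radius_lhs (cmod z) \<le> 0" if "z \<noteq> 0"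
      using radius_lhs_strict_mono[of "cmod z" r1] z r1 R' that by (cases "cmod z = r1") auto
    show "2 * phi 1 (cmod z) \<le> 1 - (cmod z)\<^sup>2" if "z \<noteq> 0"
    proof -
      \<comment> \<open>Here \<open>r1 < R\<close> enters: below \<open>R\<close> the function
        \<open>R_fun\<close> is negative, which is the required bound on
        \<open>phi 1\<close>.\<close>
      have "R_fun (cmod z) < 0" using R_fun_strict_mono[of "cmod z" R] z r1 R R' that by simp
      moreover have "phi 1 (cmod z) = (- cmod z - ln (1 - cmod z)) / cmod z"
        using z r1 R' that by (intro phi_1_eq) auto
      ultimately show ?thesis by (simp only: R_fun_def)
    qed
  qed (use f in auto)
  have sharp: "\<not> (\<forall>f\<in>bounded_class. \<forall>a. (\<forall>z\<in>ball 0 1. (\<lambda>n. a n * z ^ n) sums f z) \<longrightarrow>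
      (\<forall>z. cmod z \<le> \<rho> \<longrightarrow> cesaro_bohr_ineq f a z))" if \<rho>: "r1 < \<rho>" "\<rho> < 1" for \<rho>
  proof
    assume "\<forall>f\<in>bounded_class. \<forall>a. (\<forall>z\<in>ball 0 1. (\<lambda>n. a n * z ^ n) sums f z) \<longrightarrow>
      (\<forall>z. cmod z \<le> \<rho> \<longrightarrow> cesaro_bohr_ineq f a z)"
    \<comment> \<open>The assumed inequality is applied at the point \<open>z = \<rho>\<close> of
      the positive axis.\<close>
    then have "radius_lhs \<rho> \<le> 0"
      using \<rho> r1 by (intro radius_lhs_nonpos_if_ineq) auto
    then show False
      using radius_lhs_strict_mono[OF r1(1) \<rho>] r1 by simp
  qed
  show ?thesis
  proof (intro conjI)
    show "\<exists>!R::real. 0 < R \<and> R < 1 \<and> 2 * (- R - ln (1 - R)) = R * (1 - R\<^sup>2)"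
      unfolding R_iff by blast
    show "\<exists>!r1::real. 0 < r1 \<and> r1 < 1 \<and> radius_lhs r1 = 0"
      unfolding r1_iff by blast
    have approx: "\<bar>R - 0.493411\<bar> \<le> 0.0000005" using R unfolding abs_le_iff by simp
    show "\<forall>R r1::real.
          0 < R \<and> R < 1 \<and> 2 * (- R - ln (1 - R)) = R * (1 - R\<^sup>2)
          \<and> 0 < r1 \<and> r1 < 1 \<and> radius_lhs r1 = 0 \<longrightarrow>
            \<bar>R - 0.493411\<bar> \<le> 0.0000005
          \<and> r1 \<le> R
          \<and> (\<forall>f\<in>bounded_class. \<forall>a. (\<forall>z\<in>ball 0 1. (\<lambda>n. a n * z ^ n) sums f z) \<longrightarrow>
                (\<forall>z. cmod z \<le> r1 \<longrightarrow> cesaro_bohr_ineq f a z))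
          \<and> (\<forall>\<rho>. r1 < \<rho> \<and> \<rho> < 1 \<longrightarrow>
                \<not> (\<forall>f\<in>bounded_class. \<forall>a. (\<forall>z\<in>ball 0 1. (\<lambda>n. a n * z ^ n) sums f z) \<longrightarrow>
                      (\<forall>z. cmod z \<le> \<rho> \<longrightarrow> cesaro_bohr_ineq f a z)))"
    proof (intro allI, rule impI)
      fix S s :: real
      assume roots: "0 < S \<and> S < 1 \<and> 2 * (- S - ln (1 - S)) = S * (1 - S\<^sup>2)
        \<and> 0 < s \<and> s < 1 \<and> radius_lhs s = 0"
      then have S: "S = R" using R_iff[of S] by blast
      have s: "s = r1" using roots r1_iff[of s] by blast
      show "\<bar>S - 0.493411\<bar> \<le> 0.0000005
          \<and> s \<le> S
          \<and> (\<forall>f\<in>bounded_class. \<forall>a. (\<forall>z\<in>ball 0 1. (\<lambda>n. a n * z ^ n) sums f z) \<longrightarrow>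
                (\<forall>z. cmod z \<le> s \<longrightarrow> cesaro_bohr_ineq f a z))
          \<and> (\<forall>\<rho>. s < \<rho> \<and> \<rho> < 1 \<longrightarrow>
                \<not> (\<forall>f\<in>bounded_class. \<forall>a. (\<forall>z\<in>ball 0 1. (\<lambda>n. a n * z ^ n) sums f z) \<longrightarrow>
                      (\<forall>z. cmod z \<le> \<rho> \<longrightarrow> cesaro_bohr_ineq f a z)))"
        unfolding S s
      proof (intro conjI ballI allI impI)
        show "\<bar>R - 0.493411\<bar> \<le> 0.0000005" by (rule approx)
        show "r1 \<le> R" using r1 by simp
      qed (use upper sharp in \<open>fast+\<close>)
    qed
  qed
qed

end
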